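(* Let $X\in 2^\omega$ be a real with $X \geq_{tt} 0'$. Then there exists a real $Y$ such that $Y \oplus 0' \equiv_{tt} Y' \equiv_{tt} X$.
   Context: Reals are elements of $2^\omega$. A Turing functional $\Phi$ is a truth-table reduction if there is a computable $f:\omega\to\omega$ such that for every $n$ and every binary string $\sigma$ of length $f(n)$, $\Phi^\sigma(n)$ converges; $A\leq_{tt}B$ means $\Phi(B)=A$ for some truth-table reduction $\Phi$, and $A\equiv_{tt}B$ means $A\leq_{tt}B$ and $B\leq_{tt}A$. $Y'$ denotes the Turing jump of $Y$, $0'$ the halting set, and $A\oplus B=\{2n:n\in A\}\cup\{2n+1:n\in B\}$. *)

theory Defs
  imports Main "HOL-Library.Nat_Bijection"
begin

text \<open>Programs for partial recursive functions relative to an oracle.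
  Functions take a list of natural-number arguments; missing arguments read as 0.
  Orc queries the oracle at its first argument and returns 1 (true) or 0 (false);
  if the oracle is undefined there (finite string oracle queried beyond its length),
  the computation diverges.\<close>

datatype rf = Z | S | Proj nat | Comp rf "rf list" | Prec rf rf | Mn rf | Orc

definition arg :: "nat \<Rightarrow> nat list \<Rightarrow> nat" where
  "arg i xs = (if i < length xs then xs ! i else 0)"

inductive eval :: "(nat \<Rightarrow> bool option) \<Rightarrow> rf \<Rightarrow> nat list \<Rightarrow> nat \<Rightarrow> bool"
  for Or :: "nat \<Rightarrow> bool option" where
  eval_Z: "eval Or Z xs 0"
| eval_S: "eval Or S xs (Suc (arg 0 xs))"
| eval_Proj: "eval Or (Proj i) xs (arg i xs)"
| eval_Orc: "Or (arg 0 xs) = Some b \<Longrightarrow> eval Or Orc xs (if b then 1 else 0)"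
| eval_Comp: "length ys = length gs \<Longrightarrow> (\<forall>i<length gs. eval Or (gs ! i) xs (ys ! i))
     \<Longrightarrow> eval Or f ys z \<Longrightarrow> eval Or (Comp f gs) xs z"
| eval_Prec0: "eval Or f ys z \<Longrightarrow> eval Or (Prec f g) (0 # ys) z"
| eval_PrecS: "eval Or (Prec f g) (x # ys) y \<Longrightarrow> eval Or g (x # y # ys) z
     \<Longrightarrow> eval Or (Prec f g) (Suc x # ys) z"
| eval_Mn: "eval Or f (y # xs) 0 \<Longrightarrow> (\<forall>z<y. \<exists>v. 0 < v \<and> eval Or f (z # xs) v)
     \<Longrightarrow> eval Or (Mn f) xs y"

primrec encode :: "rf \<Rightarrow> nat" where
  "encode Z = 0"
| "encode S = 1"
| "encode Orc = 2"
| "encode (Proj i) = 3 + 7 * i"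
| "encode (Comp f gs) = 4 + 7 * prod_encode (encode f, list_encode (map encode gs))"
| "encode (Prec f g) = 5 + 7 * prod_encode (encode f, encode g)"
| "encode (Mn f) = 6 + 7 * encode f"

definition set_oracle :: "nat set \<Rightarrow> nat \<Rightarrow> bool option" where
  "set_oracle A n = Some (n \<in> A)"

definition str_oracle :: "bool list \<Rightarrow> nat \<Rightarrow> bool option" where
  "str_oracle \<sigma> n = (if n < length \<sigma> then Some (\<sigma> ! n) else None)"

definition chi :: "nat set \<Rightarrow> nat \<Rightarrow> nat" where
  "chi A n = (if n \<in> A then 1 else 0)"

definition jump :: "nat set \<Rightarrow> nat set" where
  "jump Y = {n. \<exists>p. encode p = n \<and> (\<exists>v. eval (set_oracle Y) p [n] v)}"

definition halting :: "nat set" where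
  "halting = jump {}"

definition join :: "nat set \<Rightarrow> nat set \<Rightarrow> nat set" where
  "join A B = {2 * n | n. n \<in> A} \<union> {2 * n + 1 | n. n \<in> B}"

definition computable :: "(nat \<Rightarrow> nat) \<Rightarrow> bool" where
  "computable f \<longleftrightarrow> (\<exists>q. \<forall>n. eval (\<lambda>_. None) q [n] (f n))"

definition tt_functional :: "rf \<Rightarrow> bool" where
  "tt_functional p \<longleftrightarrow> (\<exists>f. computable f \<and>
     (\<forall>n \<sigma>. length \<sigma> = f n \<longrightarrow> (\<exists>v. eval (str_oracle \<sigma>) p [n] v)))"

definition tt_le :: "nat set \<Rightarrow> nat set \<Rightarrow> bool" where
  "tt_le A B \<longleftrightarrow> (\<exists>p. tt_functional p \<and> (\<forall>n. eval (set_oracle B) p [n] (chi A n)))"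

definition tt_eq :: "nat set \<Rightarrow> nat set \<Rightarrow> bool" where
  "tt_eq A B \<longleftrightarrow> tt_le A B \<and> tt_le B A"

end

theory Submission
  imports Defs "HOL-Library.More_List"
begin

text \<open>
  Finite-extension forcing does not give truth-table reductions, because the search for a forcing
  extension diverges on a wrong oracle. Instead one forces with the effectively closed classes
  \<open>{Y. Y' \<inter> H = {}}\<close>, \<open>H\<close> finite, as in the superlow basis theorem: to decide \<open>e \<in> Y'\<close>, ask
  \<open>0'\<close> whether adding \<open>e\<close> to \<open>H\<close> makes the class empty, and add it if not. The next class depends
  only on the answers, so there is no search and the use is bounded.
  To code \<open>X\<close> as well, start inside a class of diagonally nonrecursive type: a nonempty subclass
  then yields effectively a number \<open>n\<close> such that the subclass has members containing \<open>n\<close> and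
  members omitting \<open>n\<close>, and \<open>e \<in> X\<close> is coded as \<open>n \<in> Y\<close>. The run of the construction can be retraced from
  \<open>X \<oplus> 0'\<close> and equally from \<open>Y \<oplus> 0'\<close>, and it computes both \<open>Y'\<close> and \<open>X\<close>.
\<close>

section \<open>Evaluation and derivations\<close>

lemma arg_eq_nth_default: "arg i xs = nth_default 0 xs i"
  by (simp add: arg_def nth_default_def)

lemma arg_simps [simp]:
  "arg i [] = 0" "arg 0 (x # xs) = x" "arg (Suc i) (x # xs) = arg i xs"
  "arg (numeral k) (x # xs) = arg (pred_numeral k) xs"
  by (simp_all add: arg_def numeral_eq_Suc)

lemma eval_deterministic: "eval Or p xs v \<Longrightarrow> eval Or p xs w \<Longrightarrow> v = w"
proof (induction arbitrary: w rule: eval.induct)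
  case (eval_Comp ys gs xs f z)
  from eval_Comp.prems obtain ys' where ys': "length ys' = length gs"
    "\<forall>i<length gs. eval Or (gs ! i) xs (ys' ! i)" "eval Or f ys' w"
    by (cases rule: eval.cases) auto
  with eval_Comp have "ys = ys'" by (intro nth_equalityI) auto
  with ys' eval_Comp.IH show ?case by blast
next
  case (eval_Prec0 f ys z g)
  from eval_Prec0.prems show ?case
    by (cases rule: eval.cases) (auto intro: eval_Prec0.IH)
next
  case (eval_PrecS f g x ys y z)
  from eval_PrecS.prems obtain y'
    where "eval Or (Prec f g) (x # ys) y'" "eval Or g (x # y' # ys) w"
    by (cases rule: eval.cases) auto
  with eval_PrecS.IH show ?case by blast
next
  case (eval_Mn f y xs)
  from eval_Mn.prems have zero: "eval Or f (w # xs) 0"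
    and positive: "\<forall>z<w. \<exists>v>0. eval Or f (z # xs) v"
    by (cases rule: eval.cases; auto)+
  have "\<not> y < w" using positive eval_Mn.IH by fastforce
  moreover have "\<not> w < y" using zero eval_Mn.IH by fastforce
  ultimately show ?case by simp
qed (auto elim: eval.cases)

lemma eval_unique: "eval Or p xs v \<Longrightarrow> eval Or p xs w \<longleftrightarrow> w = v"
  by (metis eval_deterministic)

lemma eval_OrcI: "Or (arg 0 xs) = Some b \<Longrightarrow> v = of_bool b \<Longrightarrow> eval Or Orc xs v"
  using eval_Orc[of Or xs b] by (cases b) auto

lemma eval_CompI: "list_all2 (\<lambda>g. eval Or g xs) gs ys \<Longrightarrow> eval Or f ys z \<Longrightarrow> eval Or (Comp f gs) xs z"
  by (auto simp: list_all2_conv_all_nth intro: eval_Comp)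

type_synonym judgement = "rf \<times> nat list \<times> nat"

fun justified :: "(nat \<Rightarrow> bool option) \<Rightarrow> judgement set \<Rightarrow> judgement \<Rightarrow> bool" where
  "justified Or J (Z, xs, v) \<longleftrightarrow> v = 0"
| "justified Or J (S, xs, v) \<longleftrightarrow> v = Suc (arg 0 xs)"
| "justified Or J (Proj i, xs, v) \<longleftrightarrow> v = arg i xs"
| "justified Or J (Orc, xs, v) \<longleftrightarrow> (\<exists>b. Or (arg 0 xs) = Some b \<and> v = of_bool b)"
| "justified Or J (Comp f gs, xs, v) \<longleftrightarrow>
     (\<exists>ys. list_all2 (\<lambda>g y. (g, xs, y) \<in> J) gs ys \<and> (f, ys, v) \<in> J)"
| "justified Or J (Prec f g, [], v) \<longleftrightarrow> False"
| "justified Or J (Prec f g, 0 # xs, v) \<longleftrightarrow> (f, xs, v) \<in> J"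
| "justified Or J (Prec f g, Suc n # xs, v) \<longleftrightarrow>
     (\<exists>y. (Prec f g, n # xs, y) \<in> J \<and> (g, n # y # xs, v) \<in> J)"
| "justified Or J (Mn f, xs, v) \<longleftrightarrow> (f, v # xs, 0) \<in> J \<and> (\<forall>z<v. \<exists>u>0. (f, z # xs, u) \<in> J)"

lemmas justified_cases =
  justified.cases [case_names Z S Proj Orc Comp Prec_Nil Prec_0 Prec_Suc Mn]

text \<open>No order among the judgements is needed for soundness, because every rule passes to a
  subprogram or decreases the first argument of a primitive recursion.\<close>

definition derivation :: "(nat \<Rightarrow> bool option) \<Rightarrow> judgement set \<Rightarrow> bool" where
  "derivation Or J \<longleftrightarrow> (\<forall>t\<in>J. justified Or J t)"

lemma justified_mono:
  assumes "justified Or J t" "J \<subseteq> K" "Or \<subseteq>\<^sub>m Or'" shows "justified Or' K t"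
proof (cases "(Or, J, t)" rule: justified_cases)
  case (Orc _ _ xs v)
  then obtain b where "Or (arg 0 xs) = Some b" "v = of_bool b" using assms(1) by auto
  moreover from this(1) have "Or' (arg 0 xs) = Some b"
    using assms(3) by (metis domI map_le_def)
  ultimately show ?thesis using Orc by simp
next
  case (Comp _ _ f gs xs v)
  then obtain ys where ys: "list_all2 (\<lambda>g y. (g, xs, y) \<in> J) gs ys" "(f, ys, v) \<in> J"
    using assms(1) by auto
  from ys(1) have "list_all2 (\<lambda>g y. (g, xs, y) \<in> K) gs ys"
    by (rule list_all2_mono) (use assms(2) in blast)
  with ys(2) Comp assms(2) show ?thesis by auto
next
  case (Mn _ _ f xs v)
  with assms(1,2) show ?thesis by (simp, blast)
qed (use assms(1,2) in auto)

lemma justified_cong_oracle: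
  "Or (arg 0 (fst (snd t))) = Or' (arg 0 (fst (snd t))) \<Longrightarrow> justified Or J t \<longleftrightarrow> justified Or' J t"
  by (cases "(Or, J, t)" rule: justified_cases) auto

lemma derivation_mono: "derivation Or J \<Longrightarrow> Or \<subseteq>\<^sub>m Or' \<Longrightarrow> derivation Or' J"
  unfolding derivation_def by (blast intro: justified_mono)

lemma derivation_sound_Prec:
  assumes J: "derivation Or J"
    and f: "\<And>xs v. (f, xs, v) \<in> J \<Longrightarrow> eval Or f xs v"
    and g: "\<And>xs v. (g, xs, v) \<in> J \<Longrightarrow> eval Or g xs v"
  shows "(Prec f g, n # xs, v) \<in> J \<Longrightarrow> eval Or (Prec f g) (n # xs) v"
proof (induction n arbitrary: v)
  case 0
  then have "justified Or J (Prec f g, 0 # xs, v)" using J by (auto simp: derivation_def)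
  then show ?case by (intro eval_Prec0 f) simp
next
  case (Suc n)
  then have "justified Or J (Prec f g, Suc n # xs, v)" using J by (auto simp: derivation_def)
  then obtain y where "(Prec f g, n # xs, y) \<in> J" "(g, n # y # xs, v) \<in> J" by auto
  then show ?case by (intro eval_PrecS[of _ _ _ n xs y] Suc.IH g)
qed

lemma derivation_sound:
  assumes J: "derivation Or J" and "(p, xs, v) \<in> J" shows "eval Or p xs v"
  using assms(2)
proof (induction p arbitrary: xs v)
  have justified: "justified Or J t" if "t \<in> J" for t
    using J that by (simp add: derivation_def)
  {
    case (Comp f gs)
    obtain ys where ys: "list_all2 (\<lambda>g y. (g, xs, y) \<in> J) gs ys" "(f, ys, v) \<in> J"
      using justified[OF Comp.prems] by auto
    from ys(1) have "list_all2 (\<lambda>g. eval Or g xs) gs ys"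
      by (rule list.rel_mono_strong) (rule Comp.IH(2))
    then show ?case using Comp.IH(1)[OF ys(2)] by (rule eval_CompI)
  next
    case (Prec f g)
    obtain n ys where "xs = n # ys" using justified[OF Prec.prems] by (cases xs) auto
    with derivation_sound_Prec[OF J Prec.IH] Prec.prems show ?case by blast
  next
    case (Mn f)
    have "(f, v # xs, 0) \<in> J" "\<forall>z<v. \<exists>u>0. (f, z # xs, u) \<in> J"
      using justified[OF Mn.prems] by simp_all
    then show ?case by (intro eval_Mn) (use Mn.IH in blast)+
  next
    case Z
    with justified[OF Z] show ?case by (simp add: eval_Z)
  next
    case S
    with justified[OF S] show ?case by (simp add: eval_S)
  next
    case (Proj i)
    with justified[OF Proj] show ?case by (simp add: eval_Proj)
  next
    case Orc
    with justified[OF Orc] show ?case by (auto intro: eval_OrcI)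
  }
qed

definition derivable :: "(nat \<Rightarrow> bool option) \<Rightarrow> judgement \<Rightarrow> bool" where
  "derivable Or t \<longleftrightarrow> (\<exists>J. finite J \<and> derivation Or J \<and> t \<in> J)"

lemma derivable_step:
  assumes "finite T" "\<And>s. s \<in> T \<Longrightarrow> derivable Or s" "justified Or T t"
  shows "derivable Or t"
proof -
  obtain J where J: "\<And>s. s \<in> T \<Longrightarrow> finite (J s) \<and> derivation Or (J s) \<and> s \<in> J s"
    using assms(2) unfolding derivable_def by metis
  let ?K = "insert t (\<Union>s\<in>T. J s)"
  have "justified Or ?K t"
    by (rule justified_mono[OF assms(3) _ map_le_refl]) (use J in blast)
  moreover have "justified Or ?K r" if "s \<in> T" "r \<in> J s" for s r
  proof (rule justified_mono[OF _ _ map_le_refl])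
    show "justified Or (J s) r" using J that by (simp add: derivation_def)
    show "J s \<subseteq> ?K" using that by blast
  qed
  ultimately have "derivation Or ?K" by (auto simp: derivation_def)
  moreover have "finite ?K" using assms(1) J by blast
  ultimately show ?thesis unfolding derivable_def by blast
qed

lemma derivation_complete: "eval Or p xs v \<Longrightarrow> derivable Or (p, xs, v)"
proof (induction rule: eval.induct)
  case (eval_Orc xs b)
  then show ?case by (auto intro!: derivable_step[of "{}" Or])
next
  case (eval_Comp ys gs xs f z)
  show ?case
  proof (rule derivable_step)
    let ?T = "insert (f, ys, z) ((\<lambda>i. (gs ! i, xs, ys ! i)) ` {..<length gs})"
    show "finite ?T" by simp
    show "derivable Or s" if "s \<in> ?T" for s using that eval_Comp.IH by auto
    show "justified Or ?T (Comp f gs, xs, z)"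
      using eval_Comp.hyps by (auto simp: list_all2_conv_all_nth intro!: exI[of _ ys])
  qed
next
  case (eval_Prec0 f ys z g)
  show ?case by (rule derivable_step[of "{(f, ys, z)}"]) (use eval_Prec0.IH in auto)
next
  case (eval_PrecS f g x ys y z)
  show ?case
    by (rule derivable_step[of "{(Prec f g, x # ys, y), (g, x # y # ys, z)}"])
      (use eval_PrecS.IH in auto)
next
  case (eval_Mn f y xs)
  then obtain u where u: "\<And>z. z < y \<Longrightarrow> 0 < u z \<and> derivable Or (f, z # xs, u z)"
    by metis
  show ?case
  proof (rule derivable_step)
    let ?T = "insert (f, y # xs, 0) ((\<lambda>z. (f, z # xs, u z)) ` {..<y})"
    show "finite ?T" by simp
    show "derivable Or s" if "s \<in> ?T" for s using that u eval_Mn.IH(1) by auto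
    show "justified Or ?T (Mn f, xs, y)" using u by auto
  qed
qed (rule derivable_step[of "{}"]; simp)+

lemma eval_iff_derivation:
  "eval Or p xs v \<longleftrightarrow> (\<exists>D. derivation Or (set D) \<and> (p, xs, v) \<in> set D)"
  using derivation_sound derivation_complete unfolding derivable_def by (metis finite_list)

lemma eval_mono: "eval Or p xs v \<Longrightarrow> Or \<subseteq>\<^sub>m Or' \<Longrightarrow> eval Or' p xs v"
  unfolding eval_iff_derivation using derivation_mono by blast

definition restrict :: "nat set \<Rightarrow> nat \<Rightarrow> bool list" where
  "restrict A l = map (\<lambda>i. i \<in> A) [0..<l]"

lemma length_restrict [simp]: "length (restrict A l) = l"
  by (simp add: restrict_def)

lemma restrict_Suc: "restrict A (Suc l) = restrict A l @ [l \<in> A]"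
  by (simp add: restrict_def)

lemma nth_default_restrict [simp]: "nth_default False (restrict A l) i \<longleftrightarrow> i < l \<and> i \<in> A"
  by (auto simp: restrict_def nth_default_def)

lemma restrict_nth_default: "restrict {i. nth_default False \<sigma> i} (length \<sigma>) = \<sigma>"
  by (rule nth_equalityI) (auto simp: restrict_def nth_default_def)

lemma str_oracle_restrict: "str_oracle (restrict A l) n = (if n < l then Some (n \<in> A) else None)"
  by (simp add: str_oracle_def restrict_def)

lemma str_oracle_restrict_le: "l \<le> m \<Longrightarrow> str_oracle (restrict A l) \<subseteq>\<^sub>m str_oracle (restrict A m)"
  by (auto simp: map_le_def str_oracle_restrict split: if_splits)

lemma str_oracle_restrict_le_set_oracle: "str_oracle (restrict A l) \<subseteq>\<^sub>m set_oracle A"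
  by (auto simp: map_le_def str_oracle_restrict set_oracle_def split: if_splits)

text \<open>The use principle: a finite derivation contains only finitely many queries.\<close>

lemma eval_restrict_iff:
  "(\<exists>l. eval (str_oracle (restrict A l)) p xs v) \<longleftrightarrow> eval (set_oracle A) p xs v"
proof
  assume "eval (set_oracle A) p xs v"
  then obtain D where D: "derivation (set_oracle A) (set D)" "(p, xs, v) \<in> set D"
    unfolding eval_iff_derivation by blast
  let ?queries = "(\<lambda>t. arg 0 (fst (snd t))) ` set D"
  obtain l where "\<forall>n\<in>?queries. n < l"
    using finite_nat_set_iff_bounded[of ?queries] by auto
  then have "str_oracle (restrict A l) (arg 0 (fst (snd t))) = set_oracle A (arg 0 (fst (snd t)))"
    if "t \<in> set D" for t
    using that by (simp add: str_oracle_restrict set_oracle_def)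
  then have "derivation (str_oracle (restrict A l)) (set D)"
    using D(1) justified_cong_oracle unfolding derivation_def by blast
  with D(2) have "eval (str_oracle (restrict A l)) p xs v"
    unfolding eval_iff_derivation by blast
  then show "\<exists>l. eval (str_oracle (restrict A l)) p xs v" ..
qed (blast intro: eval_mono str_oracle_restrict_le_set_oracle)

section \<open>Basic programs\<close>

lemma eval_ProjI: "v = arg i xs \<Longrightarrow> eval Or (Proj i) xs v"
  by (simp add: eval_Proj)

lemma eval_SI: "v = Suc (arg 0 xs) \<Longrightarrow> eval Or S xs v"
  by (simp add: eval_S)

lemma eval_Comp1: "eval Or g xs y \<Longrightarrow> eval Or f [y] z \<Longrightarrow> eval Or (Comp f [g]) xs z"
  by (rule eval_CompI[of _ _ _ "[y]"]) simp_all

lemma eval_Comp2: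
  "eval Or g xs y \<Longrightarrow> eval Or h xs w \<Longrightarrow> eval Or f [y, w] z \<Longrightarrow> eval Or (Comp f [g, h]) xs z"
  by (rule eval_CompI[of _ _ _ "[y, w]"]) simp_all

lemma eval_Comp_iff:
  assumes "list_all2 (\<lambda>g. eval Or g xs) gs ys"
  shows "eval Or (Comp f gs) xs z \<longleftrightarrow> eval Or f ys z"
proof
  assume "eval Or (Comp f gs) xs z"
  then obtain ys' where ys': "length ys' = length gs"
    "\<forall>i<length gs. eval Or (gs ! i) xs (ys' ! i)" "eval Or f ys' z"
    by (cases rule: eval.cases) auto
  then have "ys' = ys"
    using assms
    by (intro nth_equalityI) (auto simp: list_all2_conv_all_nth intro: eval_deterministic)
  with ys'(3) show "eval Or f ys z" by simp
qed (rule eval_CompI[OF assms])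

lemma eval_Mn_iff:
  assumes "\<And>v. eval Or f (v # xs) (F v)"
  shows "eval Or (Mn f) xs v \<longleftrightarrow> F v = 0 \<and> (\<forall>u<v. F u \<noteq> 0)"
proof
  assume "eval Or (Mn f) xs v"
  then have "eval Or f (v # xs) 0" "\<forall>u<v. \<exists>w>0. eval Or f (u # xs) w"
    by (cases rule: eval.cases; simp)+
  then show "F v = 0 \<and> (\<forall>u<v. F u \<noteq> 0)"
    by (simp add: eval_unique[OF assms])
next
  assume "F v = 0 \<and> (\<forall>u<v. F u \<noteq> 0)"
  then show "eval Or (Mn f) xs v"
    by (intro eval_Mn) (simp_all add: eval_unique[OF assms])
qed

primrec const_prog :: "nat \<Rightarrow> rf" where
  "const_prog 0 = Z"
| "const_prog (Suc n) = Comp S [const_prog n]"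

lemma eval_const_prog: "eval Or (const_prog n) xs n"
  by (induction n) (auto intro!: eval_Z eval_Comp1 eval_SI)

definition add_prog :: rf where
  "add_prog = Prec (Proj 0) (Comp S [Proj 1])"

lemma eval_add_prog: "eval Or add_prog [x, y] (x + y)"
  unfolding add_prog_def
  by (induction x) (auto intro!: eval_Prec0 eval_PrecS eval_ProjI eval_Comp1 eval_SI)

definition pred_prog :: rf where
  "pred_prog = Prec Z (Proj 0)"

lemma eval_pred_prog: "eval Or pred_prog [x] (x - 1)"
  unfolding pred_prog_def
  by (induction x) (auto intro!: eval_Prec0 eval_PrecS eval_Z eval_ProjI)

definition diff_prog :: rf where
  "diff_prog = Comp (Prec (Proj 0) (Comp pred_prog [Proj 1])) [Proj 1, Proj 0]"

lemma eval_diff_prog: "eval Or diff_prog [x, y] (x - y)"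
proof -
  have "eval Or (Prec (Proj 0) (Comp pred_prog [Proj 1])) [y, x] (x - y)"
  proof (induction y)
    case 0
    show ?case by (auto intro!: eval_Prec0 eval_ProjI)
  next
    case (Suc y)
    show ?case
      using eval_pred_prog[of Or "x - y"]
      by (intro eval_PrecS[OF Suc] eval_Comp1[of _ _ _ "x - y"] eval_ProjI) auto
  qed
  then show ?thesis
    unfolding diff_prog_def by (rule eval_Comp2[rotated 2]) (auto intro: eval_ProjI)
qed

definition triangle_prog :: rf where
  "triangle_prog = Prec Z (Comp add_prog [Proj 1, Comp S [Proj 0]])"

lemma eval_triangle_prog: "eval Or triangle_prog [x] (triangle x)"
  unfolding triangle_prog_def
proof (induction x)
  case 0
  show ?case by (auto intro!: eval_Prec0 eval_Z)
next
  case (Suc x)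
  have "eval Or (Comp add_prog [Proj 1, Comp S [Proj 0]]) [x, triangle x] (triangle x + Suc x)"
    by (rule eval_Comp2[OF _ _ eval_add_prog]) (auto intro!: eval_Comp1 eval_SI eval_ProjI)
  with Suc show ?case by (simp add: eval_PrecS)
qed

definition pair_prog :: rf where
  "pair_prog = Comp add_prog [Comp triangle_prog [add_prog], Proj 0]"

lemma eval_pair_prog: "eval Or pair_prog [x, y] (prod_encode (x, y))"
  unfolding pair_prog_def prod_encode_def
  by (auto intro!: eval_Comp2[OF _ _ eval_add_prog] eval_ProjI
      eval_Comp1[OF eval_add_prog eval_triangle_prog])

text \<open>The sum of the two components of \<open>z\<close> is the least \<open>k\<close> with \<open>z < triangle (Suc k)\<close>.\<close>

definition component_sum_prog :: rf where
  "component_sum_prog =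
     Mn (Comp diff_prog [Comp S [Proj 1], Comp triangle_prog [Comp S [Proj 0]]])"

lemma eval_component_sum_prog: "eval Or component_sum_prog [prod_encode (a, b)] (a + b)"
proof -
  let ?z = "prod_encode (a, b)"
  have body: "eval Or
      (Comp diff_prog [Comp S [Proj 1], Comp triangle_prog [Comp S [Proj 0]]]) [k, ?z] (Suc ?z - triangle (Suc k))" for k
    by (rule eval_Comp2[OF _ _ eval_diff_prog])
      (auto intro!: eval_Comp1[OF _ eval_triangle_prog] eval_Comp1[OF eval_ProjI] eval_SI
        simp del: triangle_Suc)
  have "Suc ?z - triangle (Suc (a + b)) = 0"
    by (simp add: prod_encode_def)
  moreover have "Suc ?z - triangle (Suc k) \<noteq> 0" if "k < a + b" for k
  proof -
    have "triangle (Suc k) \<le> triangle (a + b)"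
      by (rule lift_Suc_mono_le) (use that in auto)
    then show ?thesis by (simp add: prod_encode_def del: triangle_Suc)
  qed
  ultimately show ?thesis
    unfolding component_sum_prog_def eval_Mn_iff[OF body] by blast
qed

definition fst_prog :: rf where
  "fst_prog = Comp diff_prog [Proj 0, Comp triangle_prog [component_sum_prog]]"

lemma eval_fst_prog: "eval Or fst_prog [prod_encode (a, b)] a"
proof -
  have "eval Or fst_prog [prod_encode (a, b)] (prod_encode (a, b) - triangle (a + b))"
    unfolding fst_prog_def
    by (rule eval_Comp2[OF _ _ eval_diff_prog])
      (auto intro!: eval_Comp1[OF _ eval_triangle_prog] eval_component_sum_prog eval_ProjI)
  then show ?thesis by (simp add: prod_encode_def)
qed

definition snd_prog :: rf where
  "snd_prog = Comp diff_prog [component_sum_prog, fst_prog]"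

lemma eval_snd_prog: "eval Or snd_prog [prod_encode (a, b)] b"
  using eval_Comp2[OF eval_component_sum_prog eval_fst_prog eval_diff_prog, of Or a b]
  by (simp add: snd_prog_def)

section \<open>Recursive functions between numbered types\<close>

class numbered =
  fixes godel :: "'a \<Rightarrow> nat"
  assumes inj_godel: "inj godel"

lemma godel_eq_iff: "godel x = godel y \<longleftrightarrow> x = y"
  by (rule inj_eq[OF inj_godel])

instantiation nat :: numbered
begin
definition godel_nat :: "nat \<Rightarrow> nat" where [simp]: "godel_nat n = n"
instance by standard (simp add: inj_def)
end

instantiation bool :: numbered
begin
definition godel_bool :: "bool \<Rightarrow> nat" where [simp]: "godel_bool b = of_bool b"
instance by standard (simp add: inj_def)
end

instantiation prod :: (numbered, numbered) numbered
begin
definition godel_prod :: "'a \<times> 'b \<Rightarrow> nat" where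
  "godel_prod z = prod_encode (godel (fst z), godel (snd z))"
instance
  by standard (simp add: inj_def godel_prod_def godel_eq_iff prod_eq_iff)
end

instantiation list :: (numbered) numbered
begin
definition godel_list :: "'a list \<Rightarrow> nat" where
  "godel_list xs = list_encode (map godel xs)"
instance
  by standard (simp add: inj_def godel_list_def list_encode_eq inj_map_eq_map[OF inj_godel])
end

lemma godel_Pair: "godel (a, b) = prod_encode (godel a, godel b)"
  by (simp add: godel_prod_def)

lemma godel_Nil [simp]: "godel [] = 0"
  by (simp add: godel_list_def)

lemma godel_Cons: "godel (x # xs) = Suc (godel (x, xs))"
  by (simp add: godel_list_def godel_prod_def)

lemma godel_prod_nat [simp]: "godel (z :: nat \<times> nat) = prod_encode z"
  by (cases z) (simp add: godel_Pair)

lemma godel_list_nat [simp]: "godel (xs :: nat list) = list_encode xs"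
  by (simp add: godel_list_def map_idI)

lemma length_le_godel: "length xs \<le> godel xs"
proof (induction xs)
  case (Cons x xs)
  have "godel xs \<le> godel (x, xs)"
    by (simp add: godel_Pair le_prod_encode_2)
  with Cons show ?case by (simp add: godel_Cons)
qed simp

definition recursive :: "('a::numbered \<Rightarrow> 'b::numbered) \<Rightarrow> bool" where
  "recursive f \<longleftrightarrow> (\<exists>p. \<forall>Or a. eval Or p [godel a] (godel (f a)))"

abbreviation recursive2 :: "('a::numbered \<Rightarrow> 'b::numbered \<Rightarrow> 'c::numbered) \<Rightarrow> bool" where
  "recursive2 f \<equiv> recursive (\<lambda>z. f (fst z) (snd z))"

abbreviation recursive3 ::
  "('a::numbered \<Rightarrow> 'b::numbered \<Rightarrow> 'c::numbered \<Rightarrow> 'd::numbered) \<Rightarrow> bool" where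
  "recursive3 f \<equiv> recursive (\<lambda>z. f (fst z) (fst (snd z)) (snd (snd z)))"

definition program :: "('a::numbered \<Rightarrow> 'b::numbered) \<Rightarrow> rf" where
  "program f = (SOME p. \<forall>Or a. eval Or p [godel a] (godel (f a)))"

named_theorems rec_intros

lemma recursiveI: "(\<And>Or a. eval Or p [godel a] (godel (f a))) \<Longrightarrow> recursive f"
  unfolding recursive_def by blast

lemma eval_program: "recursive f \<Longrightarrow> eval Or (program f) [godel a] (godel (f a))"
  unfolding recursive_def program_def by (drule someI_ex) blast

lemma recursive_godel_iff: "recursive (\<lambda>x. godel (f x)) \<longleftrightarrow> recursive f"
  by (simp add: recursive_def)

lemma recursive_id [rec_intros]: "recursive (\<lambda>x. x)"
  by (rule recursiveI[of "Proj 0"]) (simp add: eval_ProjI)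

lemma recursive_const [rec_intros]: "recursive (\<lambda>x. c)"
  by (rule recursiveI) (rule eval_const_prog)

lemma recursive_compose: "recursive f \<Longrightarrow> recursive g \<Longrightarrow> recursive (\<lambda>x. f (g x))"
  by (rule recursiveI) (rule eval_Comp1[OF eval_program eval_program])

lemma recursive_Pair [rec_intros]:
  assumes "recursive f" "recursive g" shows "recursive (\<lambda>x. (f x, g x))"
  unfolding recursive_def godel_Pair
  using eval_Comp2[OF assms[THEN eval_program] eval_pair_prog] by blast

lemma recursive_compose2:
  assumes "recursive2 F" "recursive f" "recursive g"
  shows "recursive (\<lambda>x. F (f x) (g x))"
  using recursive_compose[OF assms(1) recursive_Pair[OF assms(2,3)]] by simp

lemma recursive_compose3:
  assumes "recursive3 F" "recursive f" "recursive g" "recursive h"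
  shows "recursive (\<lambda>x. F (f x) (g x) (h x))"
  using recursive_compose[OF assms(1) recursive_Pair[OF assms(2) recursive_Pair[OF assms(3,4)]]]
  by simp

lemma recursive_fst [rec_intros]: "recursive f \<Longrightarrow> recursive (\<lambda>x. fst (f x))"
  by (rule recursive_compose[of fst, OF recursiveI[of fst_prog]])
    (simp add: godel_prod_def eval_fst_prog)

lemma recursive_snd [rec_intros]: "recursive f \<Longrightarrow> recursive (\<lambda>x. snd (f x))"
  by (rule recursive_compose[of snd, OF recursiveI[of snd_prog]])
    (simp add: godel_prod_def eval_snd_prog)

lemma recursive_godel [rec_intros]: "recursive f \<Longrightarrow> recursive (\<lambda>x. godel (f x))"
  unfolding recursive_godel_iff .

lemma recursive_of_bool [rec_intros]: "recursive f \<Longrightarrow> recursive (\<lambda>x. of_bool (f x) :: nat)"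
  using recursive_godel[of f] by simp

lemma recursive_prod_decode [rec_intros]: "recursive f \<Longrightarrow> recursive (\<lambda>x. prod_decode (f x))"
  by (subst recursive_godel_iff[symmetric]) simp

lemma recursive_list_decode [rec_intros]: "recursive f \<Longrightarrow> recursive (\<lambda>x. list_decode (f x))"
  by (subst recursive_godel_iff[symmetric]) simp

lemma recursive_Suc [rec_intros]: "recursive f \<Longrightarrow> recursive (\<lambda>x. Suc (f x))"
  by (rule recursive_compose[of Suc, OF recursiveI[of S]]) (simp add: eval_SI)

lemma recursive2I:
  assumes "\<And>Or m n. eval Or p [m, n] (F m n)" shows "recursive2 F"
proof (rule recursiveI)
  fix Or and z :: "nat \<times> nat"
  show "eval Or (Comp p [fst_prog, snd_prog]) [godel z] (godel (F (fst z) (snd z)))"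
    using eval_Comp2[OF eval_fst_prog eval_snd_prog assms, of Or "fst z" "snd z"] by simp
qed

lemma recursive_add [rec_intros]:
  "recursive f \<Longrightarrow> recursive g \<Longrightarrow> recursive (\<lambda>x. f x + g x :: nat)"
  by (rule recursive_compose2[OF recursive2I[OF eval_add_prog]])

lemma recursive_diff [rec_intros]:
  "recursive f \<Longrightarrow> recursive g \<Longrightarrow> recursive (\<lambda>x. f x - g x :: nat)"
  by (rule recursive_compose2[OF recursive2I[OF eval_diff_prog]])

lemma recursive_rec_nat [rec_intros]:
  assumes "recursive g" "recursive3 s" "recursive n"
  shows "recursive (\<lambda>x. rec_nat (g x) (s x) (n x))"
proof -
  let ?s = "\<lambda>z. s (fst z) (fst (snd z)) (snd (snd z))"
  let ?arrange = "Comp pair_prog [Proj 2, Comp pair_prog [Proj 0, Proj 1]]"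
  let ?step = "Comp (program ?s) [?arrange]"
  have step: "eval Or ?step [i, godel y, godel x] (godel (s x i y))" for Or x i y
  proof (rule eval_Comp1)
    show "eval Or ?arrange [i, godel y, godel x] (godel (x, i, y))"
      unfolding godel_Pair godel_nat_def
      by (intro eval_Comp2[OF _ _ eval_pair_prog] eval_ProjI) auto
    show "eval Or (program ?s) [godel (x, i, y)] (godel (s x i y))"
      using eval_program[OF assms(2), of Or "(x, i, y)"] by simp
  qed
  have "eval Or (Prec (program g) ?step) [k, godel x] (godel (rec_nat (g x) (s x) k))" for Or k x
  proof (induction k)
    case 0
    show ?case by (simp add: eval_Prec0 eval_program[OF assms(1)])
  next
    case (Suc k)
    then show ?case using step[of Or k _ x] by (auto intro: eval_PrecS)
  qed
  then show ?thesis
    by (intro recursiveI[of "Comp (Prec (program g) ?step) [program n, Proj 0]"]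
        eval_Comp2[OF _ eval_ProjI])
      (use eval_program[OF assms(3)] in auto)
qed

lemma recursive_If [rec_intros]:
  assumes "recursive P" "recursive f" "recursive g"
  shows "recursive (\<lambda>x. if P x then f x else g x)"
proof -
  have "(\<lambda>x. if P x then f x else g x) = (\<lambda>x. rec_nat (g x) (\<lambda>_ _. f x) (godel (P x)))"
    by auto
  then show ?thesis by (simp only:) (intro rec_intros assms recursive_compose[OF assms(2)])
qed

lemma recursive_not [rec_intros]:
  assumes "recursive P" shows "recursive (\<lambda>x. \<not> P x)"
proof -
  have "(\<lambda>x. \<not> P x) = (\<lambda>x. if P x then False else True)" by auto
  then show ?thesis by (simp only:) (intro rec_intros assms)
qed

lemma recursive_conj [rec_intros]:
  assumes "recursive P" "recursive Q" shows "recursive (\<lambda>x. P x \<and> Q x)"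
proof -
  have "(\<lambda>x. P x \<and> Q x) = (\<lambda>x. if P x then Q x else False)" by auto
  then show ?thesis by (simp only:) (intro rec_intros assms)
qed

lemma recursive_disj [rec_intros]:
  assumes "recursive P" "recursive Q" shows "recursive (\<lambda>x. P x \<or> Q x)"
proof -
  have "(\<lambda>x. P x \<or> Q x) = (\<lambda>x. if P x then True else Q x)" by auto
  then show ?thesis by (simp only:) (intro rec_intros assms)
qed

lemma recursive_imp [rec_intros]:
  assumes "recursive P" "recursive Q" shows "recursive (\<lambda>x. P x \<longrightarrow> Q x)"
  unfolding imp_conv_disj by (intro rec_intros assms)

lemma recursive_less [rec_intros]:
  assumes "recursive f" "recursive g" shows "recursive (\<lambda>x. f x < (g x :: nat))"
proof -
  have "m < n \<longleftrightarrow> rec_nat False (\<lambda>_ _. True) (n - m)" for m n :: nat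
    by (cases "n - m") auto
  then show ?thesis by (simp only:) (intro rec_intros assms)
qed

lemma recursive_le [rec_intros]:
  assumes "recursive f" "recursive g" shows "recursive (\<lambda>x. f x \<le> (g x :: nat))"
  unfolding not_less[symmetric] by (intro rec_intros assms)

lemma recursive_eq [rec_intros]:
  assumes "recursive f" "recursive g" shows "recursive (\<lambda>x. f x = g x)"
proof -
  have "f x = g x \<longleftrightarrow> godel (f x) \<le> godel (g x) \<and> godel (g x) \<le> godel (f x)" for x
    by (simp add: eq_iff[symmetric] godel_eq_iff)
  then show ?thesis by (simp only:) (intro rec_intros assms)
qed

lemma recursive_mult [rec_intros]:
  assumes "recursive f" "recursive g" shows "recursive (\<lambda>x. f x * g x :: nat)"
proof -
  have "m * n = rec_nat 0 (\<lambda>_ r. r + n) m" for m n :: nat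
    by (induction m) auto
  then show ?thesis
    by (simp only:) (intro rec_intros assms recursive_compose[OF assms(2)])
qed

lemma recursive_Least:
  fixes P :: "'a::numbered \<Rightarrow> nat \<Rightarrow> bool"
  assumes "recursive2 P" "\<And>x. \<exists>n. P x n"
  shows "recursive (\<lambda>x. LEAST n. P x n)"
proof -
  let ?f = "\<lambda>z. if P (fst z) (snd z) then 0 else 1 :: nat"
  let ?test = "Comp (program ?f) [Comp pair_prog [Proj 1, Proj 0]]"
  have test: "eval Or ?test (n # [godel x]) (?f (x, n))" for Or n and x :: 'a
  proof (rule eval_Comp1)
    show "eval Or (Comp pair_prog [Proj 1, Proj 0]) (n # [godel x]) (godel (x, n))"
      unfolding godel_Pair by (intro eval_Comp2[OF _ _ eval_pair_prog] eval_ProjI) auto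
    have "recursive ?f" by (intro rec_intros assms(1))
    then show "eval Or (program ?f) [godel (x, n)] (?f (x, n))"
      using eval_program[of ?f Or "(x, n)"] by simp
  qed
  show ?thesis
  proof (rule recursiveI)
    fix Or and x :: 'a
    have "P x (LEAST n. P x n)" using assms(2) by (rule LeastI_ex)
    then show "eval Or (Mn ?test) [godel x] (godel (LEAST n. P x n))"
      unfolding godel_nat_def eval_Mn_iff[OF test] by (auto dest: not_less_Least)
  qed
qed

lemma recursive_div [rec_intros]:
  assumes "recursive f" "recursive g" shows "recursive (\<lambda>x. f x div g x :: nat)"
proof -
  have ex: "\<exists>q. n = 0 \<or> m < n * Suc q" for m n :: nat
    by (metis dividend_less_times_div gr0I mult_Suc_right)
  have "m div n = (LEAST q. n = 0 \<or> m < n * Suc q)" for m n :: nat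
  proof (rule Least_equality[symmetric])
    show "n = 0 \<or> m < n * Suc (m div n)"
      using dividend_less_times_div[of n m] by auto
    show "m div n \<le> q" if "n = 0 \<or> m < n * Suc q" for q
      using that less_mult_imp_div_less[of m "Suc q" n] by (auto simp: mult.commute)
  qed
  moreover have "recursive (\<lambda>x. LEAST q. g x = 0 \<or> f x < g x * Suc q)"
    by (intro recursive_Least ex rec_intros assms[THEN recursive_compose])
  ultimately show ?thesis by simp
qed

lemma recursive_mod [rec_intros]:
  assumes "recursive f" "recursive g" shows "recursive (\<lambda>x. f x mod g x :: nat)"
  unfolding minus_mult_div_eq_mod[symmetric] by (intro rec_intros assms)

lemma recursive_odd [rec_intros]:
  assumes "recursive f" shows "recursive (\<lambda>x. odd (f x :: nat))"
  unfolding odd_iff_mod_2_eq_one by (intro rec_intros assms)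

subsection \<open>Lists\<close>

lemma recursive_Cons [rec_intros]:
  assumes "recursive f" "recursive g" shows "recursive (\<lambda>x. f x # g x)"
  by (subst recursive_godel_iff[symmetric], unfold godel_Cons) (intro rec_intros assms)

lemma recursive_hd_tl: "recursive (\<lambda>xs. (hd xs, tl xs))"
proof (rule recursiveI)
  fix Or and xs :: "'a list"
  let ?nil = "godel (hd ([] :: 'a list), [] :: 'a list)"
  have "eval Or (Prec (const_prog ?nil) (Proj 0)) [n] (case n of 0 \<Rightarrow> ?nil | Suc m \<Rightarrow> m)" for n
    by (induction n) (auto intro!: eval_Prec0 eval_PrecS eval_const_prog eval_ProjI)
  from this[of "godel xs"]
  show "eval Or (Prec (const_prog ?nil) (Proj 0)) [godel xs] (godel (hd xs, tl xs))"
    by (cases xs) (auto simp: godel_Cons)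
qed

lemma recursive_hd [rec_intros]: "recursive f \<Longrightarrow> recursive (\<lambda>x. hd (f x))"
  using recursive_fst[OF recursive_compose[OF recursive_hd_tl]] by simp

lemma recursive_tl [rec_intros]: "recursive f \<Longrightarrow> recursive (\<lambda>x. tl (f x))"
  using recursive_snd[OF recursive_compose[OF recursive_hd_tl]] by simp

lemma fold_eq_rec_nat:
  assumes "length xs \<le> n"
  shows "fold f xs a = snd (rec_nat (xs, a)
    (\<lambda>_ r. if fst r = [] then r else (tl (fst r), f (hd (fst r)) (snd r))) n)"
proof -
  let ?s = "\<lambda>r. if fst r = [] then r else (tl (fst r), f (hd (fst r)) (snd r))"
  have first_step: "rec_nat r (\<lambda>_. ?s) (Suc n) = rec_nat (?s r) (\<lambda>_. ?s) n" for n r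
    by (induction n) auto
  show ?thesis
    using assms
  proof (induction n arbitrary: xs a)
    case (Suc n)
    show ?case
    proof (cases xs)
      case Nil
      then have "rec_nat (xs, a) (\<lambda>_. ?s) m = (xs, a)" for m by (induction m) auto
      with Nil show ?thesis by simp
    next
      case (Cons y ys)
      with Suc have "fold f ys (f y a) = snd (rec_nat (ys, f y a) (\<lambda>_. ?s) n)" by simp
      with Cons first_step[of "(xs, a)" n] show ?thesis by simp
    qed
  qed simp
qed

lemma recursive_fold [rec_intros]:
  assumes "recursive3 f" "recursive xs" "recursive a"
  shows "recursive (\<lambda>x. fold (f x) (xs x) (a x))"
  unfolding fold_eq_rec_nat[OF length_le_godel]
  by (intro rec_intros assms(2,3) recursive_compose3[OF assms(1)])

lemma recursive_rev [rec_intros]: "recursive xs \<Longrightarrow> recursive (\<lambda>x. rev (xs x))"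
  unfolding rev_conv_fold by (intro rec_intros)

lemma recursive_append [rec_intros]:
  assumes "recursive xs" "recursive ys" shows "recursive (\<lambda>x. xs x @ ys x)"
proof -
  have "xs x @ ys x = fold (#) (rev (xs x)) (ys x)" for x
    by (simp add: fold_Cons_rev)
  then show ?thesis by (simp only:) (intro rec_intros assms)
qed

lemma recursive_concat [rec_intros]:
  assumes "recursive xss" shows "recursive (\<lambda>x. concat (xss x))"
proof -
  have "concat yss = fold (\<lambda>ys r. r @ ys) yss []" for yss :: "'b list list"
    by (induction yss rule: rev_induct) auto
  then show ?thesis by (simp only:) (intro rec_intros assms)
qed

lemma recursive_map [rec_intros]:
  assumes "recursive2 f" "recursive xs"
  shows "recursive (\<lambda>x. map (f x) (xs x))"
proof -
  have "map g ys = fold (\<lambda>y r. r @ [g y]) ys []" for g :: "'b \<Rightarrow> 'c" and ys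
    by (induction ys rule: rev_induct) auto
  then show ?thesis
    by (simp only:) (intro rec_intros assms(2) recursive_compose2[OF assms(1)])
qed

lemma recursive_sum_list [rec_intros]:
  assumes "recursive xs" shows "recursive (\<lambda>x. sum_list (xs x) :: nat)"
proof -
  have "sum_list ys = fold (+) ys 0" for ys :: "nat list"
    by (simp add: fold_plus_sum_list_rev)
  then show ?thesis by (simp only:) (intro rec_intros assms)
qed

lemma recursive_Bex [rec_intros]:
  assumes "recursive2 P" "recursive xs"
  shows "recursive (\<lambda>x. \<exists>y\<in>set (xs x). P x y)"
proof -
  have "(\<exists>y\<in>set ys. Q y) = fold (\<lambda>y r. Q y \<or> r) ys False" for Q :: "'b \<Rightarrow> bool" and ys
    by (induction ys rule: rev_induct) auto
  then show ?thesis
    by (simp only:) (intro rec_intros assms(2) recursive_compose2[OF assms(1)])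
qed

lemma recursive_Ball [rec_intros]:
  assumes "recursive2 P" "recursive xs"
  shows "recursive (\<lambda>x. \<forall>y\<in>set (xs x). P x y)"
proof -
  have "(\<forall>y\<in>set (xs x). P x y) = (\<not> (\<exists>y\<in>set (xs x). \<not> P x y))" for x by auto
  then show ?thesis by (simp only:) (intro rec_intros assms)
qed

lemma recursive_mem [rec_intros]:
  assumes "recursive f" "recursive xs" shows "recursive (\<lambda>x. f x \<in> set (xs x))"
proof -
  have "(f x \<in> set (xs x)) = (\<exists>y\<in>set (xs x). y = f x)" for x by auto
  then show ?thesis by (simp only:) (intro rec_intros assms recursive_compose[OF assms(1)])
qed

lemma recursive_length [rec_intros]:
  assumes "recursive xs" shows "recursive (\<lambda>x. length (xs x))"
proof -
  have "length ys = sum_list (map (\<lambda>_. 1) ys)" for ys :: "'b list"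
    by (induction ys) auto
  then show ?thesis by (simp only:) (intro rec_intros assms)
qed

lemma recursive_upt [rec_intros]:
  assumes "recursive n" shows "recursive (\<lambda>x. [0..<n x])"
proof -
  have "[0..<n] = rec_nat [] (\<lambda>i r. r @ [i]) n" for n by (induction n) auto
  then show ?thesis by (simp only:) (intro rec_intros assms)
qed

lemma recursive_all_less [rec_intros]:
  fixes P :: "'a::numbered \<Rightarrow> nat \<Rightarrow> bool"
  assumes "recursive2 P" "recursive n" shows "recursive (\<lambda>x. \<forall>i<n x. P x i)"
proof -
  have "(\<forall>i<n x. P x i) = (\<forall>i\<in>set [0..<n x]. P x i)" for x by auto
  then show ?thesis by (simp only:) (intro rec_intros assms)
qed

lemma recursive_ex_less [rec_intros]:
  fixes P :: "'a::numbered \<Rightarrow> nat \<Rightarrow> bool"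
  assumes "recursive2 P" "recursive n" shows "recursive (\<lambda>x. \<exists>i<n x. P x i)"
proof -
  have "(\<exists>i<n x. P x i) = (\<exists>i\<in>set [0..<n x]. P x i)" for x by auto
  then show ?thesis by (simp only:) (intro rec_intros assms)
qed

lemma recursive_nth_default [rec_intros]:
  assumes "recursive xs" "recursive i" shows "recursive (\<lambda>x. nth_default d (xs x) (i x))"
proof -
  have drop: "drop k ys = rec_nat ys (\<lambda>_. tl) k" for k and ys :: "'b list"
    by (induction k) (auto simp: drop_Suc simp flip: tl_drop)
  have "nth_default d ys k = hd (drop k ys @ [d])" for k ys
    by (auto simp: nth_default_def hd_append hd_drop_conv_nth not_less)
  then show ?thesis by (simp only: drop) (intro rec_intros assms)
qed

lemma recursive_arg [rec_intros]:
  "recursive i \<Longrightarrow> recursive xs \<Longrightarrow> recursive (\<lambda>x. arg (i x) (xs x))"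
  unfolding arg_eq_nth_default by (intro rec_intros)

lemma recursive_n_lists [rec_intros]:
  assumes "recursive n" "recursive xs" shows "recursive (\<lambda>x. List.n_lists (n x) (xs x))"
proof -
  have "List.n_lists k ys = rec_nat [[]] (\<lambda>_ zss. concat (map (\<lambda>zs. map (\<lambda>y. y # zs) ys) zss)) k"
    for k and ys :: "'b list"
    by (induction k) simp_all
  then show ?thesis
    by (simp only:) (intro rec_intros assms recursive_compose[OF assms(2)])
qed

lemma recursive_all_bool_lists [rec_intros]:
  assumes "recursive2 P" "recursive l"
  shows "recursive (\<lambda>x. \<forall>\<sigma> :: bool list. length \<sigma> = l x \<longrightarrow> P x \<sigma>)"
proof -
  have "set (List.n_lists k [False, True]) = {\<sigma>. length \<sigma> = k}" for k
    by (auto simp: set_n_lists)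
  then have "(\<forall>\<sigma>. length \<sigma> = l x \<longrightarrow> P x \<sigma>) \<longleftrightarrow>
      (\<forall>\<sigma>\<in>set (List.n_lists (l x) [False, True]). P x \<sigma>)" for x
    by simp
  then show ?thesis by (simp only:) (intro rec_intros assms)
qed

subsection \<open>Decoding\<close>

class decodable = numbered +
  assumes recursive_range_godel: "recursive (\<lambda>n. n \<in> range (godel :: 'a \<Rightarrow> nat))"

lemma recursive_mem_range_godel [rec_intros]:
  "recursive f \<Longrightarrow> recursive (\<lambda>x. f x \<in> range (godel :: 'a::decodable \<Rightarrow> nat))"
  by (rule recursive_compose[OF recursive_range_godel])

instance nat :: decodable
  by standard (simp add: recursive_const)

instance bool :: decodable
proof
  have "n \<in> range (godel :: bool \<Rightarrow> nat) \<longleftrightarrow> n < 2" for n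
    by (auto simp: image_iff less_2_cases_iff)
  then show "recursive (\<lambda>n. n \<in> range (godel :: bool \<Rightarrow> nat))"
    by (simp only:) (intro rec_intros)
qed

instance prod :: (decodable, decodable) decodable
proof
  have "n = godel z \<longleftrightarrow> prod_decode n = (godel (fst z), godel (snd z))" for n and z :: "'a \<times> 'b"
    by (metis godel_prod_def prod_decode_inverse prod_encode_inverse)
  then have "n \<in> range (godel :: 'a \<times> 'b \<Rightarrow> nat) \<longleftrightarrow>
      fst (prod_decode n) \<in> range (godel :: 'a \<Rightarrow> nat) \<and>
      snd (prod_decode n) \<in> range (godel :: 'b \<Rightarrow> nat)" for n
    by (auto simp: image_iff prod_eq_iff)
  then show "recursive (\<lambda>n. n \<in> range (godel :: 'a \<times> 'b \<Rightarrow> nat))"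
    by (simp only:) (intro rec_intros)
qed

instance list :: (decodable) decodable
proof
  have "n \<in> range (godel :: 'a list \<Rightarrow> nat) \<longleftrightarrow>
      (\<forall>k\<in>set (list_decode n). k \<in> range (godel :: 'a \<Rightarrow> nat))" for n
  proof -
    have "n \<in> range (godel :: 'a list \<Rightarrow> nat) \<longleftrightarrow> (\<exists>xs :: 'a list. list_decode n = map godel xs)"
      by (metis godel_list_def list_decode_inverse list_encode_inverse rangeE rangeI)
    then show ?thesis by (auto simp: ex_map_conv image_iff)
  qed
  then show "recursive (\<lambda>n. n \<in> range (godel :: 'a list \<Rightarrow> nat))"
    by (simp only:) (intro rec_intros)
qed

definition ungodel :: "nat \<Rightarrow> 'a::decodable" where
  "ungodel = inv godel"

lemma ungodel_godel [simp]: "ungodel (godel x) = x"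
  by (simp add: ungodel_def inj_godel)

lemma ex_ungodel_iff: "(\<exists>n. P (ungodel n)) \<longleftrightarrow> (\<exists>x. P x)"
  by (metis ungodel_godel)

text \<open>Outside the range of \<^const>\<open>godel\<close>, Hilbert choice picks from the empty predicate, so that
  \<^const>\<open>ungodel\<close> is constant there.\<close>

lemma recursive_ungodel [rec_intros]:
  assumes "recursive f" shows "recursive (\<lambda>x. ungodel (f x) :: 'a::decodable)"
proof -
  have "godel (ungodel n :: 'a) =
      (if n \<in> range (godel :: 'a \<Rightarrow> nat) then n else godel (SOME x :: 'a. False))" for n
  proof (cases "n \<in> range (godel :: 'a \<Rightarrow> nat)")
    case False
    then have "(godel (x :: 'a) = n) = False" for x by blast
    with False show ?thesis by (simp add: ungodel_def inv_def)
  qed (simp add: ungodel_def f_inv_into_f)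
  then show ?thesis
    by (subst recursive_godel_iff[symmetric], simp only:) (intro rec_intros assms)
qed

lemma recursive_choice:
  fixes P :: "'a::numbered \<Rightarrow> 'b::decodable \<Rightarrow> bool"
  assumes "recursive2 P" "\<And>x. \<exists>y. P x y"
  obtains g where "recursive g" "\<And>x. P x (g x)"
proof -
  let ?n = "\<lambda>x. LEAST n. P x (ungodel n)"
  have ex: "\<exists>n. P x (ungodel n)" for x
    unfolding ex_ungodel_iff by (rule assms(2))
  have "recursive (\<lambda>x. ungodel (?n x) :: 'b)"
    by (intro rec_intros recursive_Least ex recursive_compose2[OF assms(1)])
  moreover have "P x (ungodel (?n x))" for x
    using ex[of x] by (rule LeastI_ex)
  ultimately show thesis by (rule that)
qed

section \<open>Programs as data\<close>

lemma inj_encode: "inj encode"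
proof (rule injI)
  fix p q show "encode p = encode q \<Longrightarrow> p = q"
  proof (induction p arbitrary: q)
    case (Comp f gs)
    from Comp.prems obtain f' gs' where q: "q = Comp f' gs'" "encode f = encode f'"
      "map encode gs = map encode gs'"
      by (cases q) (auto simp: list_encode_eq, presburger+)
    then have "gs = gs'"
      by (metis Comp.IH(2) map_eq_imp_length_eq nth_equalityI nth_map nth_mem)
    with q Comp.IH(1) show ?case by simp
  next
    case (Prec f g)
    then show ?case by (cases q) (auto, presburger+)
  next
    case (Mn f)
    then show ?case by (cases q) (auto, presburger+)
  next
    case (Proj i)
    then show ?case by (cases q) (auto, presburger+)
  next
    case Z
    then show ?case by (cases q) simp_all
  next
    case S
    then show ?case by (cases q) simp_all
  next
    case Orc
    then show ?case by (cases q) simp_all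
  qed
qed

lemma encode_eq_iff: "encode p = encode q \<longleftrightarrow> p = q"
  by (rule inj_eq[OF inj_encode])

instantiation rf :: numbered
begin
definition godel_rf :: "rf \<Rightarrow> nat" where [simp]: "godel_rf = encode"
instance by standard (simp add: inj_encode)
end

lemma recursive_encode [rec_intros]: "recursive f \<Longrightarrow> recursive (\<lambda>x. encode (f x))"
  using recursive_godel[of f] by simp

lemma encode_Comp_eq_godel: "encode (Comp f gs) = 4 + 7 * godel (f, gs)"
  by (simp add: godel_Pair godel_list_def)

lemma encode_Prec_eq_godel: "encode (Prec f g) = 5 + 7 * godel (f, g)"
  by (simp add: godel_Pair)

lemma recursive_Comp [rec_intros]:
  assumes "recursive f" "recursive gs" shows "recursive (\<lambda>x. Comp (f x) (gs x))"
  by (subst recursive_godel_iff[symmetric], unfold godel_rf_def encode_Comp_eq_godel)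
    (intro rec_intros assms)

lemma recursive_const_prog [rec_intros]:
  assumes "recursive n" shows "recursive (\<lambda>x. const_prog (n x))"
proof -
  have "const_prog k = rec_nat Z (\<lambda>_ p. Comp S [p]) k" for k
    by (induction k) simp_all
  then show ?thesis by (simp only:) (intro rec_intros assms)
qed

definition subcodes :: "nat \<Rightarrow> nat list" where
  "subcodes n =
    (let (a, b) = prod_decode (n div 7) in
     if n mod 7 = 4 then a # list_decode b
     else if n mod 7 = 5 then [a, b]
     else if n mod 7 = 6 then [n div 7] else [])"

lemma recursive_subcodes [rec_intros]:
  assumes "recursive n" shows "recursive (\<lambda>x. subcodes (n x))"
  unfolding subcodes_def Let_def case_prod_unfold by (intro rec_intros assms)

lemma mem_less_list_encode: "k \<in> set xs \<Longrightarrow> k < list_encode xs"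
proof (induction xs)
  case (Cons x xs)
  then show ?case
    using le_prod_encode_1[of x "list_encode xs"] le_prod_encode_2[of "list_encode xs" x]
    by (auto simp: less_Suc_eq_le)
qed simp

lemma subcodes_less:
  assumes "k \<in> set (subcodes n)" shows "k < n"
proof -
  obtain a b where ab: "prod_decode (n div 7) = (a, b)" by (cases "prod_decode (n div 7)")
  then have pair: "n div 7 = prod_encode (a, b)" by (metis prod_decode_inverse)
  have "a \<le> n div 7" "b \<le> n div 7"
    unfolding pair by (rule le_prod_encode_1, rule le_prod_encode_2)
  moreover have "n div 7 < n" if "n mod 7 \<noteq> 0"
    using that by (cases "n = 0") auto
  moreover have "k < b" if "k \<in> set (list_decode b)"
    using mem_less_list_encode[OF that] by simp
  ultimately show ?thesis
    using assms ab by (auto simp: subcodes_def split: if_splits)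
qed

lemma mem_range_encodeI:
  "3 + 7 * i \<in> range encode"
  "a \<in> range encode \<Longrightarrow> set (list_decode b) \<subseteq> range encode \<Longrightarrow>
     4 + 7 * prod_encode (a, b) \<in> range encode"
  "a \<in> range encode \<Longrightarrow> b \<in> range encode \<Longrightarrow> 5 + 7 * prod_encode (a, b) \<in> range encode"
  "a \<in> range encode \<Longrightarrow> 6 + 7 * a \<in> range encode"
proof -
  show "3 + 7 * i \<in> range encode"
    by (rule range_eqI[of _ _ "Proj i"]) simp
  show "4 + 7 * prod_encode (a, b) \<in> range encode"
    if "a \<in> range encode" "set (list_decode b) \<subseteq> range encode"
  proof -
    from that obtain f where "a = encode f" by blast
    moreover from that(2) have "\<forall>c\<in>set (list_decode b). \<exists>g. c = encode g" by blast
    then obtain gs where "list_decode b = map encode gs" unfolding ex_map_conv[symmetric] ..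
    then have "b = list_encode (map encode gs)" by (metis list_decode_inverse)
    ultimately show ?thesis by (intro range_eqI[of _ _ "Comp f gs"]) simp
  qed
  show "5 + 7 * prod_encode (a, b) \<in> range encode" if "a \<in> range encode" "b \<in> range encode"
  proof -
    from that obtain f g where "a = encode f" "b = encode g" by blast
    then show ?thesis by (intro range_eqI[of _ _ "Prec f g"]) simp
  qed
  show "6 + 7 * a \<in> range encode" if "a \<in> range encode"
  proof -
    from that obtain f where "a = encode f" by blast
    then show ?thesis by (intro range_eqI[of _ _ "Mn f"]) simp
  qed
qed

lemma mem_range_encode_if_subcodes:
  assumes shape: "n < 3 \<or> 3 \<le> n mod 7" and sub: "set (subcodes n) \<subseteq> range encode"
  shows "n \<in> range encode"
proof -
  obtain a b where ab: "prod_decode (n div 7) = (a, b)" by (cases "prod_decode (n div 7)")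
  then have pair: "n div 7 = prod_encode (a, b)" by (metis prod_decode_inverse)
  have n_eq: "n mod 7 + 7 * (n div 7) = n" by simp
  have "n mod 7 < 7" by simp
  with shape consider (basic) "n < 3" | (Proj) "n mod 7 = 3" | (Comp) "n mod 7 = 4"
    | (Prec) "n mod 7 = 5" | (Mn) "n mod 7 = 6"
    by linarith
  then show ?thesis
  proof cases
    case basic
    then have "n = encode Z \<or> n = encode S \<or> n = encode Orc" by auto
    then show ?thesis by blast
  next
    case Proj
    with n_eq mem_range_encodeI(1)[of "n div 7"] show ?thesis by simp
  next
    case Comp
    with sub ab have "4 + 7 * prod_encode (a, b) \<in> range encode"
      by (intro mem_range_encodeI(2)) (auto simp: subcodes_def)
    with Comp pair n_eq show ?thesis by simp
  next
    case Prec
    with sub ab have "5 + 7 * prod_encode (a, b) \<in> range encode"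
      by (intro mem_range_encodeI(3)) (auto simp: subcodes_def)
    with Prec pair n_eq show ?thesis by simp
  next
    case Mn
    with sub have "6 + 7 * (n div 7) \<in> range encode"
      by (intro mem_range_encodeI(4)) (auto simp: subcodes_def)
    with Mn n_eq show ?thesis by simp
  qed
qed

lemma mem_range_encode_iff:
  "n \<in> range encode \<longleftrightarrow> (n < 3 \<or> 3 \<le> n mod 7) \<and> set (subcodes n) \<subseteq> range encode"
proof
  assume "n \<in> range encode"
  then obtain p where "n = encode p" ..
  then show "(n < 3 \<or> 3 \<le> n mod 7) \<and> set (subcodes n) \<subseteq> range encode"
    by (cases p) (auto simp: subcodes_def)
qed (blast intro: mem_range_encode_if_subcodes)

definition codes_below :: "nat \<Rightarrow> nat list" where
  "codes_below = rec_nat [] (\<lambda>n cs.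
     if (n < 3 \<or> 3 \<le> n mod 7) \<and> (\<forall>k\<in>set (subcodes n). k \<in> set cs) then n # cs else cs)"

lemma set_codes_below: "set (codes_below n) = range encode \<inter> {..<n}"
proof (induction n)
  case (Suc n)
  have "(\<forall>k\<in>set (subcodes n). k \<in> set (codes_below n)) \<longleftrightarrow> set (subcodes n) \<subseteq> range encode"
    unfolding Suc using subcodes_less by blast
  then have "set (codes_below (Suc n)) =
      (if n \<in> range encode then insert n (set (codes_below n)) else set (codes_below n))"
    by (subst mem_range_encode_iff) (simp add: codes_below_def)
  then show ?case by (auto simp: Suc less_Suc_eq)
qed (simp add: codes_below_def)

instance rf :: decodable
proof
  have "n \<in> range encode \<longleftrightarrow> n \<in> set (codes_below (Suc n))" for n
    unfolding set_codes_below by simp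
  then show "recursive (\<lambda>n. n \<in> range (godel :: rf \<Rightarrow> nat))"
    by (simp only: godel_rf_def) (unfold codes_below_def, intro rec_intros)
qed

lemma case_rf_eq_ungodel:
  "(case p of Z \<Rightarrow> z | S \<Rightarrow> s | Proj i \<Rightarrow> pr i | Comp f gs \<Rightarrow> co f gs | Prec f g \<Rightarrow> pc f g
     | Mn f \<Rightarrow> mn f | Orc \<Rightarrow> orc) =
   (let n = encode p; k = n div 7 in
    if n = 0 then z else if n = 1 then s else if n = 2 then orc
    else if n mod 7 = 3 then pr k
    else if n mod 7 = 4 then (case ungodel k of (f, gs) \<Rightarrow> co f gs)
    else if n mod 7 = 5 then (case ungodel k of (f, g) \<Rightarrow> pc f g)
    else mn (ungodel k))"
proof (cases p)
  case (Comp f gs)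
  then have "encode p div 7 = godel (f, gs)" "encode p mod 7 = 4" "encode p > 2"
    unfolding Comp encode_Comp_eq_godel by simp_all
  with Comp show ?thesis by (simp add: Let_def del: encode.simps)
next
  case (Prec f g)
  then have "encode p div 7 = godel (f, g)" "encode p mod 7 = 5" "encode p > 2"
    unfolding Prec encode_Prec_eq_godel by simp_all
  with Prec show ?thesis by (simp add: Let_def del: encode.simps)
next
  case (Mn f)
  have "ungodel (encode f) = f" using ungodel_godel[of f] by simp
  with Mn show ?thesis by (simp add: Let_def)
qed simp_all

lemma recursive_case_rf [rec_intros]:
  assumes "recursive p" "recursive z" "recursive s" "recursive2 pr" "recursive3 co"
    "recursive3 pc" "recursive2 mn" "recursive orc"
  shows "recursive (\<lambda>x. case p x of Z \<Rightarrow> z x | S \<Rightarrow> s x | Proj i \<Rightarrow> pr x i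
    | Comp f gs \<Rightarrow> co x f gs | Prec f g \<Rightarrow> pc x f g | Mn f \<Rightarrow> mn x f | Orc \<Rightarrow> orc x)"
  unfolding case_rf_eq_ungodel Let_def case_prod_unfold
  by (intro rec_intros assms recursive_compose2[OF assms(4)] recursive_compose3[OF assms(5)]
      recursive_compose3[OF assms(6)] recursive_compose2[OF assms(7)])

text \<open>All quantifiers become bounded by the list, which makes justification decidable.\<close>

lemma justified_set_eq_case:
  "justified (str_oracle \<sigma>) (set D) (p, xs, v) \<longleftrightarrow> (case p of
     Z \<Rightarrow> v = 0
   | S \<Rightarrow> v = Suc (arg 0 xs)
   | Proj i \<Rightarrow> v = arg i xs
   | Comp f gs \<Rightarrow> \<exists>t\<in>set D. fst t = f \<and> snd (snd t) = v \<and> length (fst (snd t)) = length gs \<and>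
       (\<forall>i<length gs. (nth_default Z gs i, xs, arg i (fst (snd t))) \<in> set D)
   | Prec f g \<Rightarrow> xs \<noteq> [] \<and>
       (if hd xs = 0 then (f, tl xs, v) \<in> set D
        else \<exists>t\<in>set D. fst t = p \<and> fst (snd t) = (hd xs - 1) # tl xs \<and>
          (g, (hd xs - 1) # snd (snd t) # tl xs, v) \<in> set D)
   | Mn f \<Rightarrow> (f, v # xs, 0) \<in> set D \<and>
       (\<forall>z<v. \<exists>t\<in>set D. fst t = f \<and> fst (snd t) = z # xs \<and> 0 < snd (snd t))
   | Orc \<Rightarrow> arg 0 xs < length \<sigma> \<and> v = of_bool (nth_default False \<sigma> (arg 0 xs)))"
proof (cases "(str_oracle \<sigma>, set D, p, xs, v)" rule: justified_cases)
  case (Comp _ _ f gs xs v)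
  have "list_all2 (\<lambda>g y. (g, xs, y) \<in> set D) gs ys \<longleftrightarrow> length ys = length gs \<and>
      (\<forall>i<length gs. (nth_default Z gs i, xs, arg i ys) \<in> set D)" for ys
    by (auto simp: list_all2_conv_all_nth nth_default_def arg_def)
  with Comp show ?thesis by (simp add: Bex_def) blast
next
  case (Prec_Suc _ _ f g n xs v)
  then show ?thesis by (simp add: Bex_def)
next
  case (Mn _ _ f xs v)
  then show ?thesis by (simp add: Bex_def) blast
qed (auto simp: str_oracle_def nth_default_def)

lemma recursive_justified:
  assumes "recursive s" "recursive D" "recursive p" "recursive xs" "recursive v"
  shows "recursive (\<lambda>x. justified (str_oracle (s x)) (set (D x)) (p x, xs x, v x))"
  unfolding justified_set_eq_case by (intro rec_intros assms assms[THEN recursive_compose])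

lemma recursive_derivation [rec_intros]:
  assumes "recursive s" "recursive D"
  shows "recursive (\<lambda>x. derivation (str_oracle (s x)) (set (D x)))"
proof -
  have "derivation (str_oracle (s x)) (set (D x)) \<longleftrightarrow>
      (\<forall>t\<in>set (D x). justified (str_oracle (s x)) (set (D x))
        (fst t, fst (snd t), snd (snd t)))" for x
    by (simp add: derivation_def)
  then show ?thesis
    by (simp only:) (intro rec_intros recursive_justified assms assms[THEN recursive_compose])
qed

definition curry_prog :: "rf \<Rightarrow> nat \<Rightarrow> rf" where
  "curry_prog p n = Comp p [Comp pair_prog [const_prog n, Proj 0]]"

lemma eval_curry_prog:
  fixes x :: nat
  shows "eval Or (curry_prog p (godel a)) [x] v \<longleftrightarrow> eval Or p [godel (a, x)] v"
  unfolding curry_prog_def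
proof (rule eval_Comp_iff)
  have "eval Or (Comp pair_prog [const_prog (godel a), Proj 0]) [x] (godel (a, x))"
    unfolding godel_Pair
    by (intro eval_Comp2[OF eval_const_prog _ eval_pair_prog] eval_ProjI) simp
  then show "list_all2 (\<lambda>g. eval Or g [x]) [Comp pair_prog [const_prog (godel a), Proj 0]]
      [godel (a, x)]"
    by simp
qed

lemma recursive_curry_prog [rec_intros]:
  assumes "recursive n" shows "recursive (\<lambda>x. curry_prog p (n x))"
  unfolding curry_prog_def by (intro rec_intros assms)

definition search_prog ::
  "('a::numbered \<Rightarrow> nat \<Rightarrow> nat) \<Rightarrow> ('a \<Rightarrow> nat \<Rightarrow> bool \<Rightarrow> bool) \<Rightarrow> rf" where
  "search_prog q test =
    (let arguments = Comp pair_prog [Proj 1, Proj 0];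
         query = Comp Orc [Comp (program (\<lambda>z. q (fst z) (snd z))) [arguments]];
         failure = program (\<lambda>z. \<not> test (fst (fst z)) (snd (fst z)) (snd z))
     in Mn (Comp failure [Comp pair_prog [arguments, query]]))"

lemma eval_search_prog_iff:
  assumes q: "recursive2 q" and test: "recursive3 test"
  shows "eval (set_oracle A) (search_prog q test) [godel a] v \<longleftrightarrow>
    test a v (q a v \<in> A) \<and> (\<forall>u<v. \<not> test a u (q a u \<in> A))"
proof -
  let ?arguments = "Comp pair_prog [Proj 1, Proj 0]"
  let ?query = "Comp Orc [Comp (program (\<lambda>z. q (fst z) (snd z))) [?arguments]]"
  let ?failed = "\<lambda>z. \<not> test (fst (fst z)) (snd (fst z)) (snd z)"
  have arguments: "eval (set_oracle A) ?arguments (u # [godel a]) (godel (a, u))" for u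
    unfolding godel_Pair by (intro eval_Comp2[OF _ _ eval_pair_prog] eval_ProjI) auto
  have "eval (set_oracle A) ?query (u # [godel a]) (godel (q a u \<in> A))" for u
  proof (rule eval_Comp1[OF eval_Comp1[OF arguments]])
    show "eval (set_oracle A) (program (\<lambda>z. q (fst z) (snd z))) [godel (a, u)] (q a u)"
      using eval_program[OF q, of "set_oracle A" "(a, u)"] by simp
    show "eval (set_oracle A) Orc [q a u] (godel (q a u \<in> A))"
      by (rule eval_OrcI) (simp_all add: set_oracle_def)
  qed
  then have input: "eval (set_oracle A) (Comp pair_prog [?arguments, ?query]) (u # [godel a])
      (godel ((a, u), q a u \<in> A))" for u
    using eval_Comp2[OF arguments _ eval_pair_prog] unfolding godel_Pair[of "(a, u)"] by blast
  have "recursive ?failed"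
    by (intro rec_intros recursive_compose3[OF test])
  then have body: "eval (set_oracle A)
      (Comp (program ?failed) [Comp pair_prog [?arguments, ?query]]) (u # [godel a])
      (of_bool (\<not> test a u (q a u \<in> A)))" for u
    using eval_Comp1[OF input eval_program, of ?failed u] by simp
  show ?thesis
    unfolding search_prog_def Let_def eval_Mn_iff[OF body] by simp
qed

section \<open>Truth-table reducibility\<close>

lemma chi_eq_of_bool: "chi A n = of_bool (n \<in> A)"
  by (simp add: chi_def)

lemma computable_iff_recursive: "computable f \<longleftrightarrow> recursive f"
proof
  assume "computable f"
  then obtain p where "\<And>n. eval Map.empty p [n] (f n)"
    unfolding computable_def by blast
  then have "eval Or p [n] (f n)" for Or n
    by (rule eval_mono) simp
  then show "recursive f" by (intro recursiveI[of p]) simp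
qed (auto simp: computable_def recursive_def)

definition answers_prog :: rf where
  "answers_prog = Prec Z (Comp S [Comp pair_prog [Comp Orc [Proj 0], Proj 1]])"

lemma eval_answers_prog:
  assumes "\<And>i. i < m \<Longrightarrow> Or i = Some (b i)"
  shows "eval Or answers_prog [m] (godel (rev (map b [0..<m])))"
  using assms
proof (induction m)
  case 0
  show ?case by (auto simp: answers_prog_def intro!: eval_Prec0 eval_Z)
next
  case (Suc m)
  let ?answers = "rev (map b [0..<m])"
  have "eval Or (Comp S [Comp pair_prog [Comp Orc [Proj 0], Proj 1]]) [m, godel ?answers]
      (Suc (prod_encode (of_bool (b m), godel ?answers)))"
    using Suc.prems[of m]
    by (intro eval_Comp1[OF eval_Comp2[OF _ _ eval_pair_prog]] eval_SI eval_Comp1[OF eval_ProjI]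
        eval_OrcI[of _ _ "b m"] eval_ProjI) auto
  moreover have "eval Or answers_prog [m] (godel ?answers)"
    using Suc by simp
  ultimately show ?case
    by (simp add: answers_prog_def eval_PrecS godel_Cons godel_Pair)
qed

definition table_prog :: "(nat \<Rightarrow> nat) \<Rightarrow> (nat \<Rightarrow> bool list \<Rightarrow> bool) \<Rightarrow> rf" where
  "table_prog u t = Comp (program (\<lambda>z. t (fst z) (rev (snd z))))
     [Comp pair_prog [Proj 0, Comp answers_prog [program u]]]"

lemma eval_table_prog:
  assumes u: "recursive u" and t: "recursive2 t"
    and answers: "\<And>i. i < u n \<Longrightarrow> Or i = Some (b i)"
  shows "eval Or (table_prog u t) [n] (of_bool (t n (map b [0..<u n])))"
proof -
  let ?answers = "rev (map b [0..<u n])"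
  let ?t = "\<lambda>z. t (fst z) (rev (snd z))"
  have "eval Or (Comp answers_prog [program u]) [n] (godel ?answers)"
    using eval_Comp1[OF _ eval_answers_prog[OF answers]] eval_program[OF u, of Or n] by simp
  then have "eval Or (Comp pair_prog [Proj 0, Comp answers_prog [program u]]) [n]
      (godel (n, ?answers))"
    unfolding godel_Pair by (intro eval_Comp2[OF eval_ProjI _ eval_pair_prog]) auto
  moreover have "recursive ?t"
    by (intro rec_intros recursive_compose2[OF t])
  ultimately show ?thesis
    using eval_Comp1[OF _ eval_program, of Or _ "[n]" "(n, ?answers)" ?t]
    by (simp add: table_prog_def)
qed

lemma tt_leI:
  assumes u: "recursive u" and t: "recursive2 t" and A: "\<And>n. n \<in> A \<longleftrightarrow> t n (restrict B (u n))"
  shows "tt_le A B"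
proof -
  have "tt_functional (table_prog u t)"
    unfolding tt_functional_def
  proof (intro exI[of _ u] conjI allI impI)
    show "computable u" using u by (simp add: computable_iff_recursive)
    fix n and \<sigma> :: "bool list" assume "length \<sigma> = u n"
    then show "\<exists>v. eval (str_oracle \<sigma>) (table_prog u t) [n] v"
      using eval_table_prog[OF u t, of n "str_oracle \<sigma>" "\<lambda>i. \<sigma> ! i"]
      by (auto simp: str_oracle_def)
  qed
  moreover have "eval (set_oracle B) (table_prog u t) [n] (chi A n)" for n
    using eval_table_prog[OF u t, of n "set_oracle B" "\<lambda>i. i \<in> B"] A[of n]
    by (simp add: set_oracle_def chi_eq_of_bool restrict_def)
  ultimately show ?thesis unfolding tt_le_def by blast
qed

lemma tt_leE:
  assumes "tt_le A B"
  obtains u t where "recursive u" "recursive2 t" "\<And>n. n \<in> A \<longleftrightarrow> t n (restrict B (u n))"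
proof -
  obtain p u where p: "\<And>n. eval (set_oracle B) p [n] (chi A n)" and u: "recursive u"
    and total: "\<And>n \<sigma>. length \<sigma> = u n \<Longrightarrow> \<exists>v. eval (str_oracle \<sigma>) p [n] v"
    using assms unfolding tt_le_def tt_functional_def computable_iff_recursive by blast
  define certifies where "certifies z d \<longleftrightarrow> (length (snd z) = u (fst z) \<longrightarrow>
      derivation (str_oracle (snd z)) (set (fst d)) \<and> (p, [fst z], snd d) \<in> set (fst d))"
    for z and d :: "judgement list \<times> nat"
  have "recursive2 certifies"
    unfolding certifies_def by (intro rec_intros recursive_compose[OF u])
  moreover have "\<exists>d. certifies z d" for z
    using total[of "snd z" "fst z"] by (auto simp: certifies_def eval_iff_derivation)
  ultimately obtain g where g: "recursive g" "\<And>z. certifies z (g z)"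
    by (rule recursive_choice) blast
  show thesis
  proof (rule that[OF u])
    show "recursive2 (\<lambda>n \<sigma>. snd (g (n, \<sigma>)) = 1)"
      by (intro rec_intros recursive_compose[OF g(1)])
    fix n
    have "eval (str_oracle (restrict B (u n))) p [n] (snd (g (n, restrict B (u n))))"
      using g(2)[of "(n, restrict B (u n))"] by (auto simp: certifies_def intro: derivation_sound)
    then have "eval (set_oracle B) p [n] (snd (g (n, restrict B (u n))))"
      by (rule eval_mono) (rule str_oracle_restrict_le_set_oracle)
    then have "snd (g (n, restrict B (u n))) = chi A n"
      using p by (rule eval_deterministic)
    then show "n \<in> A \<longleftrightarrow> snd (g (n, restrict B (u n))) = 1"
      by (simp add: chi_eq_of_bool)
  qed
qed

lemma tt_le_vimage:
  assumes "recursive g" shows "tt_le (g -` B) B"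
proof (rule tt_leI)
  show "recursive (\<lambda>n. Suc (g n))" by (intro rec_intros assms)
  show "recursive2 (\<lambda>n \<sigma>. nth_default False \<sigma> (g n))"
    by (intro rec_intros recursive_compose[OF assms])
qed simp

lemma tt_le_refl: "tt_le A A"
  using tt_le_vimage[OF recursive_id, of A] by simp

lemma tt_le_trans [trans]:
  assumes "tt_le A B" "tt_le B C" shows "tt_le A C"
proof -
  obtain u t where u: "recursive u" and t: "recursive2 t"
    and A: "\<And>n. n \<in> A \<longleftrightarrow> t n (restrict B (u n))"
    using assms(1) by (rule tt_leE) blast
  obtain u' t' where u': "recursive u'" and t': "recursive2 t'"
    and B: "\<And>n. n \<in> B \<longleftrightarrow> t' n (restrict C (u' n))"
    using assms(2) by (rule tt_leE) blast
  let ?use = "\<lambda>n. sum_list (map u' [0..<u n])"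
  let ?table = "\<lambda>n \<sigma>. t n (map (\<lambda>i. t' i (map (nth_default False \<sigma>) [0..<u' i])) [0..<u n])"
  show ?thesis
  proof (rule tt_leI)
    show "recursive ?use"
      by (intro rec_intros u recursive_compose[OF u'])
    show "recursive2 ?table"
      by (intro recursive_compose2[OF t] rec_intros recursive_compose[OF u]
          recursive_compose[OF u'] recursive_compose2[OF t'])
    fix n
    have "map (nth_default False (restrict C (?use n))) [0..<u' i] = restrict C (u' i)"
      if "i < u n" for i
    proof -
      have "u' i \<le> ?use n"
        using that by (intro member_le_sum_list) auto
      then show ?thesis by (auto simp: restrict_def[of C "u' i"])
    qed
    then have "map (\<lambda>i. t' i (map (nth_default False (restrict C (?use n))) [0..<u' i]))
        [0..<u n] = restrict B (u n)"
      by (simp add: restrict_def[of B] B)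
    then show "n \<in> A \<longleftrightarrow> ?table n (restrict C (?use n))" by (simp add: A)
  qed
qed

lemma mem_join_iff: "n \<in> join A B \<longleftrightarrow> (if odd n then n div 2 \<in> B else n div 2 \<in> A)"
proof -
  have "2 * k \<in> join A B \<longleftrightarrow> k \<in> A" "Suc (2 * k) \<in> join A B \<longleftrightarrow> k \<in> B" for k
    unfolding join_def by (auto, presburger+)
  then show ?thesis by (cases "odd n") (auto elim!: evenE oddE)
qed

lemma tt_le_join:
  assumes "tt_le A C" "tt_le B C" shows "tt_le (join A B) C"
proof -
  obtain u t where u: "recursive u" and t: "recursive2 t"
    and A: "\<And>n. n \<in> A \<longleftrightarrow> t n (restrict C (u n))"
    using assms(1) by (rule tt_leE) blast
  obtain u' t' where u': "recursive u'" and t': "recursive2 t'"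
    and B: "\<And>n. n \<in> B \<longleftrightarrow> t' n (restrict C (u' n))"
    using assms(2) by (rule tt_leE) blast
  show ?thesis
  proof (rule tt_leI)
    let ?use = "\<lambda>n. if odd n then u' (n div 2) else u (n div 2)"
    let ?table = "\<lambda>n \<sigma>. if odd n then t' (n div 2) \<sigma> else t (n div 2) \<sigma>"
    show "recursive ?use"
      by (intro rec_intros recursive_compose[OF u] recursive_compose[OF u'])
    show "recursive2 ?table"
      by (intro rec_intros recursive_compose2[OF t] recursive_compose2[OF t'])
    show "n \<in> join A B \<longleftrightarrow> ?table n (restrict C (?use n))" for n
      by (simp add: mem_join_iff A B)
  qed
qed

lemma tt_le_join_left: "tt_le A (join A B)"
proof -
  have "recursive (\<lambda>n :: nat. 2 * n)" by (intro rec_intros)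
  from tt_le_vimage[OF this, of "join A B"] show ?thesis by (simp add: vimage_def mem_join_iff)
qed

lemma tt_le_join_right: "tt_le B (join A B)"
proof -
  have "recursive (\<lambda>n :: nat. Suc (2 * n))" by (intro rec_intros)
  from tt_le_vimage[OF this, of "join A B"] show ?thesis by (simp add: vimage_def mem_join_iff)
qed

lemma tt_le_adaptive_bounded:
  fixes state :: "nat \<Rightarrow> 's::numbered"
  assumes query: "recursive2 query" and update: "recursive3 update" and use: "recursive use"
    and state: "\<And>i. state (Suc i) = update i (state i) (i \<in> A)"
    and answer: "\<And>i. i \<in> A \<longleftrightarrow> query i (state i) \<in> B"
    and bound: "\<And>i n. i \<le> n \<Longrightarrow> query i (state i) < use n"
  shows "tt_le A B"
proof (rule tt_leI[OF use])
  let ?run = "\<lambda>\<sigma>. rec_nat (state 0) (\<lambda>i s. update i s (nth_default False \<sigma> (query i s)))"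
  let ?table = "\<lambda>n \<sigma>. nth_default False \<sigma> (query n (?run \<sigma> n))"
  show "recursive2 ?table"
    by (intro rec_intros recursive_compose2[OF query] recursive_compose3[OF update])
  fix n
  have "?run (restrict B (use n)) i = state i" if "i \<le> n" for i
    using that by (induction i) (simp_all add: state answer bound)
  then show "n \<in> A \<longleftrightarrow> ?table n (restrict B (use n))"
    by (simp add: answer bound)
qed

text \<open>Only one bit is learnt per step, so that finitely many states are possible at step \<open>i\<close>;
  listing them bounds the queries without knowing the answers.\<close>

lemma tt_le_adaptive:
  fixes state :: "nat \<Rightarrow> 's::numbered"
  assumes query: "recursive2 query" and update: "recursive3 update"
    and state: "\<And>i. state (Suc i) = update i (state i) (i \<in> A)"
    and answer: "\<And>i. i \<in> A \<longleftrightarrow> query i (state i) \<in> B"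
  shows "tt_le A B"
proof -
  define possible where "possible = rec_nat [state 0]
    (\<lambda>i ss. map (\<lambda>s. update i s False) ss @ map (\<lambda>s. update i s True) ss)"
  have rec_possible: "recursive possible"
    unfolding possible_def by (intro rec_intros recursive_compose3[OF update])
  have state_possible: "state i \<in> set (possible i)" for i
  proof (induction i)
    case (Suc i)
    then show ?case by (cases "i \<in> A") (auto simp: possible_def state)
  qed (simp add: possible_def)
  define query_sum where "query_sum i = sum_list (map (query i) (possible i))" for i
  let ?use = "\<lambda>n. Suc (sum_list (map query_sum [0..<Suc n]))"
  have "recursive ?use"
    unfolding query_sum_def
    by (intro rec_intros recursive_compose2[OF query] recursive_compose[OF rec_possible])
  moreover have "query i (state i) < ?use n" if "i \<le> n" for i n
  proof -
    have "query i (state i) \<le> query_sum i"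
      unfolding query_sum_def using state_possible by (intro member_le_sum_list) auto
    also have "\<dots> \<le> sum_list (map query_sum [0..<Suc n])"
      using that by (intro member_le_sum_list) (auto simp del: upt_Suc)
    finally show ?thesis by simp
  qed
  ultimately show ?thesis
    by (rule tt_le_adaptive_bounded[where use = ?use and state = state,
          OF query update _ state answer])
qed

section \<open>The jump\<close>

lemma encode_mem_jump_iff: "encode p \<in> jump A \<longleftrightarrow> (\<exists>v. eval (set_oracle A) p [encode p] v)"
  by (auto simp: jump_def encode_eq_iff)

definition search_index ::
  "('a::numbered \<Rightarrow> 's::decodable \<Rightarrow> nat) \<Rightarrow> ('a \<Rightarrow> 's \<Rightarrow> bool \<Rightarrow> bool) \<Rightarrow> 'a \<Rightarrow> nat" where
  "search_index q test a = encode (curry_prog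
     (search_prog (\<lambda>z :: 'a \<times> nat. \<lambda>n. q (fst z) (ungodel n)) (\<lambda>z n. test (fst z) (ungodel n)))
     (godel a))"

lemma search_index_mem_jump_iff:
  assumes q: "recursive2 q" and test: "recursive3 test"
  shows "search_index q test a \<in> jump A \<longleftrightarrow> (\<exists>s. test a s (q a s \<in> A))"
proof -
  let ?holds = "\<lambda>n. test a (ungodel n) (q a (ungodel n) \<in> A)"
  have q': "recursive2 (\<lambda>z :: 'a \<times> nat. \<lambda>n. q (fst z) (ungodel n))"
    by (intro rec_intros recursive_compose2[OF q])
  have test': "recursive3 (\<lambda>z :: 'a \<times> nat. \<lambda>n. test (fst z) (ungodel n))"
    by (intro rec_intros recursive_compose3[OF test])
  have "search_index q test a \<in> jump A \<longleftrightarrow> (\<exists>n. ?holds n \<and> (\<forall>m<n. \<not> ?holds m))"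
    unfolding search_index_def encode_mem_jump_iff eval_curry_prog
      eval_search_prog_iff[OF q' test']
    by simp
  also have "\<dots> \<longleftrightarrow> (\<exists>n. ?holds n)"
    by (rule exists_least_iff[symmetric])
  also have "\<dots> \<longleftrightarrow> (\<exists>s. test a s (q a s \<in> A))"
    by (rule ex_ungodel_iff)
  finally show ?thesis .
qed

lemma recursive_search_index [rec_intros]:
  "recursive f \<Longrightarrow> recursive (\<lambda>x. search_index q test (f x))"
  unfolding search_index_def by (intro rec_intros)

definition halting_derivation :: "bool list \<Rightarrow> nat \<Rightarrow> judgement list \<Rightarrow> bool" where
  "halting_derivation \<sigma> n D \<longleftrightarrow>
     derivation (str_oracle \<sigma>) (set D) \<and> (\<exists>p v. encode p = n \<and> (p, [n], v) \<in> set D)"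

lemma recursive_halting_derivation [rec_intros]:
  assumes "recursive s" "recursive n" "recursive D"
  shows "recursive (\<lambda>x. halting_derivation (s x) (n x) (D x))"
proof -
  have "(\<exists>p v. encode p = n x \<and> (p, [n x], v) \<in> set (D x)) \<longleftrightarrow>
      (\<exists>t\<in>set (D x). encode (fst t) = n x \<and> fst (snd t) = [n x])" for x
    by force
  then show ?thesis
    unfolding halting_derivation_def
    by (simp only:) (intro rec_intros assms assms[THEN recursive_compose])
qed

lemma halting_derivation_restrict_mono:
  "halting_derivation (restrict A l) n D \<Longrightarrow> l \<le> m \<Longrightarrow> halting_derivation (restrict A m) n D"
  unfolding halting_derivation_def using derivation_mono str_oracle_restrict_le by blast

lemma mem_jump_iff_halting_derivation:
  "n \<in> jump A \<longleftrightarrow> (\<exists>l D. halting_derivation (restrict A l) n D)"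
  unfolding jump_def eval_restrict_iff[symmetric]
  unfolding eval_iff_derivation halting_derivation_def by blast

lemma recursive_restrict_empty [rec_intros]:
  assumes "recursive l" shows "recursive (\<lambda>x. restrict {} (l x))"
  unfolding restrict_def empty_iff by (intro rec_intros assms)

lemma tt_le_jump: "tt_le A (jump A)"
proof -
  let ?g = "search_index (\<lambda>n (_ :: nat). n) (\<lambda>_ _ b. b)"
  have "?g n \<in> jump A \<longleftrightarrow> n \<in> A" for n
    by (subst search_index_mem_jump_iff) (simp_all, (intro rec_intros)+)
  then have "?g -` jump A = A" by (simp add: vimage_def)
  moreover have "recursive ?g" by (intro rec_intros)
  ultimately show ?thesis using tt_le_vimage[of ?g "jump A"] by simp
qed

lemma tt_le_halting_jump: "tt_le halting (jump A)"
proof -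
  let ?g = "search_index (\<lambda>_ _. 0) (\<lambda>n s _. halting_derivation (restrict {} (fst s)) n (snd s))"
  have "?g n \<in> jump A \<longleftrightarrow> n \<in> halting" for n
    unfolding halting_def mem_jump_iff_halting_derivation[of n "{}"]
    by (subst search_index_mem_jump_iff) (simp_all, (intro rec_intros)+)
  then have "?g -` jump A = halting" by (simp add: vimage_def)
  moreover have "recursive ?g" by (intro rec_intros)
  ultimately show ?thesis using tt_le_vimage[of ?g "jump A"] by simp
qed

section \<open>Effectively closed classes\<close>

definition avoiders :: "nat set \<Rightarrow> nat set set" where
  "avoiders H = {A. jump A \<inter> H = {}}"

lemma mem_avoiders_iff: "A \<in> avoiders H \<longleftrightarrow> (\<forall>n\<in>H. n \<notin> jump A)"
  by (auto simp: avoiders_def)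

lemma avoiders_antimono: "H \<subseteq> K \<Longrightarrow> avoiders K \<subseteq> avoiders H"
  by (auto simp: avoiders_def)

definition refuted :: "nat set \<Rightarrow> bool list \<Rightarrow> bool" where
  "refuted H \<sigma> \<longleftrightarrow> (\<exists>k<length \<sigma>. \<exists>n\<in>H. halting_derivation \<sigma> n (ungodel k))"

lemma recursive_refuted [rec_intros]:
  assumes "recursive h" "recursive s"
  shows "recursive (\<lambda>x. refuted (set (h x)) (s x))"
  unfolding refuted_def by (intro rec_intros assms assms[THEN recursive_compose])

lemma refuted_restrict_mono: "refuted H (restrict A l) \<Longrightarrow> l \<le> m \<Longrightarrow> refuted H (restrict A m)"
  unfolding refuted_def using halting_derivation_restrict_mono
  by (metis length_restrict less_le_trans)

lemma ex_refuted_restrict_iff: "(\<exists>l. refuted H (restrict A l)) \<longleftrightarrow> A \<notin> avoiders H"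
proof
  assume "\<exists>l. refuted H (restrict A l)"
  then show "A \<notin> avoiders H"
    unfolding refuted_def mem_avoiders_iff mem_jump_iff_halting_derivation by blast
next
  assume "A \<notin> avoiders H"
  then obtain n l D where n: "n \<in> H" "halting_derivation (restrict A l) n D"
    unfolding mem_avoiders_iff mem_jump_iff_halting_derivation by blast
  let ?m = "max l (Suc (godel D))"
  have "halting_derivation (restrict A ?m) n (ungodel (godel D))"
    using n(2) by (simp add: halting_derivation_restrict_mono)
  moreover have "godel D < ?m" by simp
  ultimately have "refuted H (restrict A ?m)"
    using n(1) unfolding refuted_def length_restrict by blast
  then show "\<exists>l. refuted H (restrict A l)" ..
qed

lemma cluster_point:
  obtains A where "\<And>l. \<exists>k\<ge>l. restrict (B k) l = restrict A l"
proof -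
  define recurrent where
    "recurrent \<sigma> \<longleftrightarrow> (\<exists>\<^sub>F k in sequentially. restrict (B k) (length \<sigma>) = \<sigma>)" for \<sigma>
  have "recurrent []" by (simp add: recurrent_def restrict_def)
  moreover have "\<exists>b. recurrent (\<sigma> @ [b])" if "recurrent \<sigma>" for \<sigma>
  proof -
    have "\<exists>\<^sub>F k in sequentially. restrict (B k) (Suc (length \<sigma>)) = \<sigma> @ [True] \<or>
        restrict (B k) (Suc (length \<sigma>)) = \<sigma> @ [False]"
      using that unfolding recurrent_def by (rule frequently_elim1) (simp add: restrict_Suc)
    then show ?thesis
      unfolding frequently_disj_iff recurrent_def by auto
  qed
  ultimately have "\<exists>f. \<forall>l. (recurrent (f l) \<and> length (f l) = l) \<and> (\<exists>b. f (Suc l) = f l @ [b])"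
    by (intro dependent_nat_choice) fastforce+
  then obtain f where f: "\<And>l. recurrent (f l)" "\<And>l. length (f l) = l"
      "\<And>l. \<exists>b. f (Suc l) = f l @ [b]"
    by blast
  define A where "A = {l. last (f (Suc l))}"
  have "f l = restrict A l" for l
  proof (induction l)
    case 0
    show ?case using f(2)[of 0] by (simp add: restrict_def)
  next
    case (Suc l)
    then show ?case using f(3)[of l] by (auto simp: restrict_Suc A_def)
  qed
  then have "\<exists>\<^sub>F k in sequentially. restrict (B k) l = restrict A l" for l
    using f(1)[of l] by (simp add: recurrent_def)
  then have "\<exists>k\<ge>l. restrict (B k) l = restrict A l" for l
    by (auto simp: frequently_def eventually_sequentially)
  then show thesis by (rule that)
qed

lemma ex_all_refuted_iff:
  "(\<exists>l. \<forall>\<sigma>. length \<sigma> = l \<longrightarrow> refuted H \<sigma>) \<longleftrightarrow> avoiders H = {}"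
proof
  assume "\<exists>l. \<forall>\<sigma>. length \<sigma> = l \<longrightarrow> refuted H \<sigma>"
  then show "avoiders H = {}"
    using ex_refuted_restrict_iff length_restrict by blast
next
  assume empty: "avoiders H = {}"
  show "\<exists>l. \<forall>\<sigma>. length \<sigma> = l \<longrightarrow> refuted H \<sigma>"
  proof (rule ccontr)
    assume "\<not> ?thesis"
    then have "\<exists>A. \<not> refuted H (restrict A l)" for l
      by (metis restrict_nth_default)
    then obtain B where B: "\<And>l. \<not> refuted H (restrict (B l) l)" by metis
    obtain A where A: "\<And>l. \<exists>k\<ge>l. restrict (B k) l = restrict A l"
      using cluster_point[of B] by blast
    obtain l where "refuted H (restrict A l)"
      using empty ex_refuted_restrict_iff by blast
    with A[of l] B show False
      by (metis refuted_restrict_mono)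
  qed
qed

lemma avoiders_UN_nonempty:
  fixes H :: "nat \<Rightarrow> nat set"
  assumes nonempty: "\<And>i. avoiders (H i) \<noteq> {}" and "mono H"
  shows "avoiders (\<Union>i. H i) \<noteq> {}"
proof -
  have "\<exists>A. A \<in> avoiders (H i)" for i using nonempty[of i] by blast
  then obtain B where B: "\<And>i. B i \<in> avoiders (H i)" by metis
  obtain A where A: "\<And>l. \<exists>k\<ge>l. restrict (B k) l = restrict A l"
    using cluster_point[of B] by blast
  have "A \<in> avoiders (H i)" for i
  proof (rule ccontr)
    assume "A \<notin> avoiders (H i)"
    then obtain l where l: "refuted (H i) (restrict A l)"
      using ex_refuted_restrict_iff by blast
    obtain k where k: "max i l \<le> k" "restrict (B k) (max i l) = restrict A (max i l)"
      using A by blast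
    have "refuted (H i) (restrict (B k) (max i l))"
      unfolding k(2) using l by (rule refuted_restrict_mono) simp
    then have "B k \<notin> avoiders (H i)"
      using ex_refuted_restrict_iff by blast
    moreover have "avoiders (H k) \<subseteq> avoiders (H i)"
      using k(1) \<open>mono H\<close> by (intro avoiders_antimono) (simp add: monoD)
    ultimately show False using B[of k] by blast
  qed
  then have "A \<in> avoiders (\<Union>i. H i)" by (auto simp: mem_avoiders_iff)
  then show ?thesis by blast
qed

section \<open>Indices of effectively closed classes\<close>

definition empty_index :: "nat list \<Rightarrow> nat" where
  "empty_index = search_index (\<lambda>_ _. 0) (\<lambda>h l _. \<forall>\<sigma>. length \<sigma> = l \<longrightarrow> refuted (set h) \<sigma>)"

lemma recursive_empty_index [rec_intros]:
  "recursive h \<Longrightarrow> recursive (\<lambda>x. empty_index (h x))"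
  unfolding empty_index_def by (intro rec_intros)

lemma empty_index_mem_halting_iff: "empty_index h \<in> halting \<longleftrightarrow> avoiders (set h) = {}"
  unfolding empty_index_def halting_def ex_all_refuted_iff[symmetric]
  by (rule search_index_mem_jump_iff) (intro rec_intros)+

definition bit_index :: "nat \<Rightarrow> bool \<Rightarrow> nat" where
  "bit_index n b = search_index (\<lambda>z (_ :: nat). fst z) (\<lambda>z _ a. a \<noteq> snd z) (n, b)"

lemma recursive_bit_index [rec_intros]:
  "recursive n \<Longrightarrow> recursive b \<Longrightarrow> recursive (\<lambda>x. bit_index (n x) (b x))"
  unfolding bit_index_def by (intro rec_intros)

lemma bit_index_mem_jump_iff: "bit_index n b \<in> jump A \<longleftrightarrow> (n \<in> A) \<noteq> b"
  unfolding bit_index_def by (subst search_index_mem_jump_iff) (simp_all, (intro rec_intros)+)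

section \<open>Splitting subclasses of the diagonal class\<close>

text \<open>An analogue of the class of diagonally nonrecursive functions.\<close>

definition diagonal_class :: "nat set set" where
  "diagonal_class =
     {A. \<forall>p v. eval (set_oracle {}) p [encode p] v \<longrightarrow> (encode p \<in> A \<longleftrightarrow> odd v)}"

lemma diagonal_class_nonempty: "diagonal_class \<noteq> {}"
proof -
  let ?A = "{encode p | p v. eval (set_oracle {}) p [encode p] v \<and> odd v}"
  have "encode p \<in> ?A \<longleftrightarrow> odd v" if v: "eval (set_oracle {}) p [encode p] v" for p v
    by (auto simp: encode_eq_iff eval_unique[OF v])
  then have "?A \<in> diagonal_class" unfolding diagonal_class_def by blast
  then show ?thesis by blast
qed

definition diagonal_index :: nat where
  "diagonal_index = search_index (\<lambda>_ ((p, xs, v), l, D). encode p)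
     (\<lambda>_ ((p, xs, v), l, D) b. derivation (str_oracle (restrict {} l)) (set D) \<and>
        (p, xs, v) \<in> set D \<and> xs = [encode p] \<and> b \<noteq> odd v) (0 :: nat)"

lemma diagonal_index_mem_jump_iff: "diagonal_index \<in> jump A \<longleftrightarrow> A \<notin> diagonal_class"
proof -
  have "diagonal_index \<in> jump A \<longleftrightarrow>
      (\<exists>s. case s of ((p, xs, v), l, D) \<Rightarrow> derivation (str_oracle (restrict {} l)) (set D) \<and>
        (p, xs, v) \<in> set D \<and> xs = [encode p] \<and> (encode p \<in> A) \<noteq> odd v)"
    unfolding diagonal_index_def case_prod_unfold
    by (rule search_index_mem_jump_iff) (intro rec_intros)+
  also have "\<dots> \<longleftrightarrow> (\<exists>p v. (\<exists>l D. derivation (str_oracle (restrict {} l)) (set D) \<and>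
      (p, [encode p], v) \<in> set D) \<and> (encode p \<in> A) \<noteq> odd v)"
    by auto
  also have "\<dots> \<longleftrightarrow> A \<notin> diagonal_class"
    unfolding eval_iff_derivation[symmetric] eval_restrict_iff by (auto simp: diagonal_class_def)
  finally show ?thesis .
qed

definition decides :: "nat list \<Rightarrow> nat \<Rightarrow> nat \<Rightarrow> bool" where
  "decides h n v \<longleftrightarrow>
     (\<forall>\<sigma>. length \<sigma> = v div 2 \<longrightarrow> refuted (insert (bit_index n (odd v)) (set h)) \<sigma>)"

lemma recursive_decides [rec_intros]:
  assumes "recursive h" "recursive n" "recursive v"
  shows "recursive (\<lambda>x. decides (h x) (n x) (v x))"
  unfolding decides_def list.set(2)[symmetric]
  by (intro rec_intros assms assms[THEN recursive_compose])

lemma ex_decides_iff: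
  "(\<exists>v. decides h n v \<and> odd v = b) \<longleftrightarrow> avoiders (insert (bit_index n b) (set h)) = {}"
proof -
  have "(\<exists>v. P (v div 2) (odd v) \<and> odd v = b) \<longleftrightarrow> (\<exists>l. P l b)" for P :: "nat \<Rightarrow> bool \<Rightarrow> bool"
  proof
    assume "\<exists>l. P l b"
    then obtain l where "P l b" ..
    then have "P ((2 * l + of_bool b) div 2) (odd (2 * l + of_bool b))" by simp
    then show "\<exists>v. P (v div 2) (odd v) \<and> odd v = b" by (intro exI[of _ "2 * l + of_bool b"]) simp
  qed blast
  then show ?thesis
    unfolding decides_def ex_all_refuted_iff[symmetric] .
qed

text \<open>Run on its own code \<open>n\<close>, this program searches for a proof that one of the two ways of
  deciding \<open>n\<close> leaves the class of \<open>h\<close> empty, and on success returns a value whose parity forces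
  all members of the diagonal class to decide \<open>n\<close> in that way.\<close>

definition split_prog :: "nat list \<Rightarrow> rf" where
  "split_prog h = curry_prog
     (search_prog (\<lambda>_ _. 0) (\<lambda>z v _. decides (fst z) (snd z) v)) (godel h)"

lemma recursive_split_prog [rec_intros]:
  "recursive h \<Longrightarrow> recursive (\<lambda>x. split_prog (h x))"
  unfolding split_prog_def by (intro rec_intros)

lemma eval_split_prog_iff:
  "eval (set_oracle A) (split_prog h) [n] v \<longleftrightarrow> decides h n v \<and> (\<forall>u<v. \<not> decides h n u)"
proof -
  have "recursive3 (\<lambda>(z :: nat list \<times> nat) v (b :: bool). decides (fst z) (snd z) v)"
    by (intro rec_intros)
  then show ?thesis
    unfolding split_prog_def eval_curry_prog
    by (subst eval_search_prog_iff[OF recursive_const]) simp_all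
qed

lemma avoiders_split_nonempty:
  assumes diagonal: "avoiders (set h) \<subseteq> diagonal_class" and nonempty: "avoiders (set h) \<noteq> {}"
  shows "avoiders (insert (bit_index (encode (split_prog h)) b) (set h)) \<noteq> {}"
proof
  let ?n = "encode (split_prog h)"
  assume "avoiders (insert (bit_index ?n b) (set h)) = {}"
  then obtain v where v: "decides h ?n v" "\<forall>u<v. \<not> decides h ?n u"
    using exists_least_iff[of "decides h ?n"] by (auto simp flip: ex_decides_iff)
  then have "eval (set_oracle {}) (split_prog h) [?n] v"
    by (simp add: eval_split_prog_iff)
  then have "?n \<in> A \<longleftrightarrow> odd v" if "A \<in> avoiders (set h)" for A
    using that diagonal unfolding diagonal_class_def by blast
  then have "avoiders (set h) \<subseteq> avoiders (insert (bit_index ?n (odd v)) (set h))"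
    by (auto simp: mem_avoiders_iff bit_index_mem_jump_iff)
  moreover have "avoiders (insert (bit_index ?n (odd v)) (set h)) = {}"
    using v(1) ex_decides_iff by blast
  ultimately show False using nonempty by blast
qed

section \<open>Jump inversion\<close>

text \<open>Step \<open>2 e\<close> decides whether \<open>e\<close> enters the jump, step \<open>2 e + 1\<close> codes \<open>e \<in> X\<close>; accordingly
  \<open>b\<close> is the truth value of \<open>e \<in> Y'\<close> or of \<open>e \<in> X\<close>.\<close>

definition extend :: "nat \<Rightarrow> nat list \<Rightarrow> bool \<Rightarrow> nat list" where
  "extend i h b =
    (if odd i then bit_index (encode (split_prog h)) b # h else if b then h else i div 2 # h)"

lemma recursive_extend: "recursive3 extend"
  unfolding extend_def by (intro rec_intros)

definition answer :: "nat set \<Rightarrow> nat \<Rightarrow> nat list \<Rightarrow> bool" where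
  "answer X i h \<longleftrightarrow> (if odd i then i div 2 \<in> X else avoiders (set (i div 2 # h)) = {})"

primrec forbidden :: "nat set \<Rightarrow> nat \<Rightarrow> nat list" where
  "forbidden X 0 = [diagonal_index]"
| "forbidden X (Suc i) = extend i (forbidden X i) (answer X i (forbidden X i))"

lemma mono_forbidden: "mono (\<lambda>i. set (forbidden X i))"
  by (rule mono_iff_le_Suc[THEN iffD2]) (auto simp: extend_def)

lemma avoiders_forbidden_subset_diagonal_class: "avoiders (set (forbidden X i)) \<subseteq> diagonal_class"
proof -
  have "avoiders (set (forbidden X i)) \<subseteq> avoiders (set (forbidden X 0))"
    by (rule avoiders_antimono[OF monoD[OF mono_forbidden]]) simp
  also have "\<dots> \<subseteq> diagonal_class"
    by (auto simp: mem_avoiders_iff diagonal_index_mem_jump_iff)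
  finally show ?thesis .
qed

lemma avoiders_forbidden_nonempty: "avoiders (set (forbidden X i)) \<noteq> {}"
proof (induction i)
  case 0
  show ?case
    using diagonal_class_nonempty by (auto simp: mem_avoiders_iff diagonal_index_mem_jump_iff)
next
  case (Suc i)
  show ?case
  proof (cases "odd i")
    case True
    then show ?thesis
      using avoiders_split_nonempty[OF avoiders_forbidden_subset_diagonal_class Suc]
      by (simp add: extend_def)
  next
    case False
    with Suc show ?thesis by (simp add: extend_def answer_def)
  qed
qed

context
  fixes X Y :: "nat set"
  assumes Y: "\<And>i. Y \<in> avoiders (set (forbidden X i))"
begin

lemma split_prog_mem_iff:
  assumes "odd i" shows "encode (split_prog (forbidden X i)) \<in> Y \<longleftrightarrow> i div 2 \<in> X"
  using Y[of "Suc i"] assms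
  by (simp add: mem_avoiders_iff extend_def answer_def bit_index_mem_jump_iff)

lemma mem_jump_iff_empty_index:
  assumes "even i" shows "i div 2 \<in> jump Y \<longleftrightarrow> empty_index (i div 2 # forbidden X i) \<in> halting"
proof -
  let ?H = "set (i div 2 # forbidden X i)"
  have "i div 2 \<notin> jump Y" if "avoiders ?H \<noteq> {}"
    using Y[of "Suc i"] that assms by (simp add: mem_avoiders_iff extend_def answer_def)
  moreover have "i div 2 \<in> jump Y" if "avoiders ?H = {}"
  proof -
    have "Y \<notin> avoiders ?H" using that by blast
    with Y[of i] show ?thesis by (auto simp: mem_avoiders_iff)
  qed
  ultimately show ?thesis unfolding empty_index_mem_halting_iff by blast
qed

lemma forbidden_Suc_join: "forbidden X (Suc i) = extend i (forbidden X i) (i \<in> join (jump Y) X)"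
  by (simp add: answer_def mem_join_iff mem_jump_iff_empty_index empty_index_mem_halting_iff)

lemma join_jump_X_tt_le_join_X_halting: "tt_le (join (jump Y) X) (join X halting)"
proof (rule tt_le_adaptive[where state = "forbidden X", OF _ recursive_extend forbidden_Suc_join])
  let ?query = "\<lambda>i h. if odd i then 2 * (i div 2) else Suc (2 * empty_index (i div 2 # h))"
  show "recursive2 ?query" by (intro rec_intros)
  show "i \<in> join (jump Y) X \<longleftrightarrow> ?query i (forbidden X i) \<in> join X halting" for i
    by (cases "odd i") (auto simp: mem_join_iff mem_jump_iff_empty_index elim: oddE)
qed

lemma join_jump_X_tt_le_join_Y_halting: "tt_le (join (jump Y) X) (join Y halting)"
proof (rule tt_le_adaptive[where state = "forbidden X", OF _ recursive_extend forbidden_Suc_join])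
  let ?query = "\<lambda>i h. if odd i then 2 * encode (split_prog h)
    else Suc (2 * empty_index (i div 2 # h))"
  show "recursive2 ?query" by (intro rec_intros)
  show "i \<in> join (jump Y) X \<longleftrightarrow> ?query i (forbidden X i) \<in> join Y halting" for i
    by (simp add: mem_join_iff mem_jump_iff_empty_index split_prog_mem_iff)
qed

end

theorem mainTheorem2:
  fixes X :: "nat set"
  assumes "tt_le halting X"
  shows "\<exists>Y :: nat set. tt_eq (join Y halting) (jump Y) \<and> tt_eq (jump Y) X"
proof -
  obtain Y where "Y \<in> avoiders (\<Union>i. set (forbidden X i))"
    using avoiders_UN_nonempty[OF avoiders_forbidden_nonempty mono_forbidden] by blast
  then have Y: "Y \<in> avoiders (set (forbidden X i))" for i
    by (auto simp: mem_avoiders_iff)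
  have jump_le_Y: "tt_le (jump Y) (join Y halting)"
    using tt_le_join_left join_jump_X_tt_le_join_Y_halting[OF Y] by (rule tt_le_trans)
  have Y_le_jump: "tt_le (join Y halting) (jump Y)"
    using tt_le_jump tt_le_halting_jump by (rule tt_le_join)
  have "tt_le (jump Y) (join X halting)"
    using tt_le_join_left join_jump_X_tt_le_join_X_halting[OF Y] by (rule tt_le_trans)
  also have "tt_le (join X halting) X"
    using tt_le_refl assms by (rule tt_le_join)
  finally have jump_le_X: "tt_le (jump Y) X" .
  have "tt_le X (join Y halting)"
    using tt_le_join_right join_jump_X_tt_le_join_Y_halting[OF Y] by (rule tt_le_trans)
  then have "tt_le X (jump Y)"
    using Y_le_jump by (rule tt_le_trans)
  with jump_le_Y Y_le_jump jump_le_X show ?thesis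
    unfolding tt_eq_def by blast
qed

end
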